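(* Fix $p\in[2,\infty)$, $d,n\in\mathbb N$ and $k\in\{1,\ldots,n\}$. Then for every $A_1,\ldots,A_n\in M_d(\mathbb R)$, $$\frac{(p/\sqrt{\log p})^{-p}}{2^n\binom nk}\sum_{\substack{S\subset\{1,\ldots,n\}\\|S|=k}}\sum_{\varepsilon\in\{-1,1\}^n}\Big\|\sum_{j\in S}\varepsilon_jA_j\Big\|_{S_p}^p\lesssim_p\frac kn\sum_{j=1}^n\|A_j\|_{S_p}^p+\frac{(k/n)^{p/2}}{2^n}\sum_{\varepsilon\in\{-1,1\}^n}\Big\|\sum_{j=1}^n\varepsilon_jA_j\Big\|_{S_p}^p.$$
   Context: For $A\in M_d(\mathbb R)$, $\|A\|_{S_p}=(\mathrm{trace}((A^*A)^{p/2}))^{1/p}$ is the Schatten $p$-norm. $a\lesssim_p b$ means $a\le c^pb$ for a universal constant $c\in(0,\infty)$. *)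

theory Defs
  imports "Jordan_Normal_Form.Char_Poly"
begin

definition sign_vectors :: "nat \<Rightarrow> (nat \<Rightarrow> real) set" where
  "sign_vectors n = {\<epsilon>. (\<forall>j\<in>{1..n}. \<epsilon> j = -1 \<or> \<epsilon> j = 1) \<and> (\<forall>j. j \<notin> {1..n} \<longrightarrow> \<epsilon> j = 0)}"

definition signed_sum :: "nat \<Rightarrow> nat set \<Rightarrow> (nat \<Rightarrow> real) \<Rightarrow> (nat \<Rightarrow> real mat) \<Rightarrow> real mat" where
  "signed_sum d S \<epsilon> A = mat d d (\<lambda>(i, l). \<Sum>j\<in>S. \<epsilon> j * A j $$ (i, l))"

text \<open>trace((A^T A)^(p/2)): the sum of the (p/2)-th powers of the eigenvalues of the
  positive semidefinite matrix A^T A, counted with algebraic multiplicity.\<close>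
definition schatten_trace_pow :: "real \<Rightarrow> real mat \<Rightarrow> real" where
  "schatten_trace_pow p M =
     (let q = char_poly (transpose_mat M * M)
      in \<Sum>x\<in>{y. poly q y = 0}. real (order x q) * x powr (p / 2))"

definition schatten_norm :: "real \<Rightarrow> real mat \<Rightarrow> real" where
  "schatten_norm p M = schatten_trace_pow p M powr (1 / p)"

end

theory Submission
  imports Defs "HOL-Analysis.Function_Topology" "HOL-Analysis.Convex"
begin

text \<open>
  Write \<open>q = p/2\<close>.  Passing to the symmetric dilations of the \<open>A\<^sub>j\<close>, the inequality follows from
  two estimates.  The noncommutative Khinchine inequality bounds the average over the signs of
  \<open>tr |\<Sum>\<^sub>S \<epsilon>\<^sub>j H\<^sub>j|\<^sup>p\<close> by \<open>(4q - 2)\<^sup>q tr (\<Sum>\<^sub>S H\<^sub>j\<^sup>2)\<^sup>q\<close>; convexity of \<open>tr Y\<^sup>q\<close> gives the reverse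
  inequality with constant 1.  A Rosenthal inequality for sums of positive semidefinite \<open>B\<^sub>j\<close>
  over a random \<open>S\<close>, with constant of order \<open>q / log q\<close>, then handles the average over \<open>S\<close>.  It is
  proved by induction on the size of \<open>S\<close> from
  \<open>tr B (Z + B)\<^sup>q\<^sup>-\<^sup>1 \<le> K tr B Z\<^sup>q\<^sup>-\<^sup>1 + L tr B\<^sup>q\<close>.

  Every trace inequality involves only two matrices \<open>Y\<close>, \<open>Z\<close> at a time.  In their eigenbases
  \<open>tr f(Y) g(Z)\<close> is the sum of \<open>f(y\<^sub>i) g(z\<^sub>j)\<close> against the nonnegative weights \<open>\<langle>u\<^sub>i, v\<^sub>j\<rangle>\<^sup>2\<close>, so it
  follows from a scalar inequality in \<open>y\<close> and \<open>z\<close>.  In particular \<open>tr (Y - Z)\<^sup>2 f(Y)\<close> has this form,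
  which is why all error terms are quadratic in \<open>Y - Z\<close>.
\<close>

section \<open>The spectral theorem for symmetric matrices\<close>

text \<open>The two losses multiply to the constant of the theorem: Khinchine costs the q-th power
  of a factor of order p, Rosenthal the q-th power of a factor of order p / log p, and (p^2 / log
  p)^q = (p / sqrt (log p))^p because p = 2 q. The bounds must not depend on the dimension, and
  since Z and B do not commute, B (Z + B)^(q-1) cannot be expanded. Instead Z is compared with Y = Z
  + B: then B = Y - Z is a difference of the two matrices in play, and no third eigenbasis has to be
  handled at the same time. Dilations enter because for a nonsymmetric A both A^T A and A A^T belong
  to the square function, and the square of the dilation contains both. The elements of a random S
  of fixed size are not independent; the substitute is the exchange of pairs (S, j) for (S - {j},
  j), which costs a factor at most 2 as long as S has at most half of the elements. For larger S
  monotonicity of the trace is enough. Khinchine and Rosenthal both close with Young's inequality: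
  its share 1 - 1/q is absorbed in the first and is the weight of the induction hypothesis in the
  second.\<close>

lemma exists_ratio_maximizer:
  fixes H :: "'i \<Rightarrow> 'i \<Rightarrow> real" and V :: "('i \<Rightarrow> real) set"
  assumes I: "finite I"
    and z: "\<forall>a. a \<notin> I \<longrightarrow> z a = 0" "(\<Sum>a\<in>I. (z a)\<^sup>2) > 0" "\<forall>v\<in>V. (\<Sum>a\<in>I. v a * z a) = 0"
  shows "\<exists>x. (\<forall>a. a \<notin> I \<longrightarrow> x a = 0) \<and> (\<Sum>a\<in>I. (x a)\<^sup>2) = 1 \<and>
    (\<forall>v\<in>V. (\<Sum>a\<in>I. v a * x a) = 0) \<and>
    (\<forall>y. (\<forall>a. a \<notin> I \<longrightarrow> y a = 0) \<longrightarrow> (\<forall>v\<in>V. (\<Sum>a\<in>I. v a * y a) = 0) \<longrightarrow>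
       (\<Sum>a\<in>I. \<Sum>b\<in>I. H a b * y a * y b) \<le> (\<Sum>a\<in>I. \<Sum>b\<in>I. H a b * x a * x b) * (\<Sum>a\<in>I. (y a)\<^sup>2))"
proof -
  define F where "F = (\<lambda>x::'i \<Rightarrow> real. \<Sum>a\<in>I. \<Sum>b\<in>I. H a b * x a * x b)"
  \<comment> \<open>\<open>Kb\<close> is a product of compact sets, hence compact by Tychonoff; the
    factors {0} outside \<open>I\<close> make this work over any index type.
    \<open>Kb \<inter> C\<close> is the unit sphere of the orthogonal complement of
    \<open>V\<close>, since unit vectors have coordinates in [-1, 1].\<close>
  define Kb where "Kb = PiE UNIV (\<lambda>a. if a \<in> I then {-1..1::real} else {0})"
  define C where "C = {x. (\<Sum>a\<in>I. (x a)\<^sup>2) = 1} \<inter> (\<Inter>v\<in>V. {x. (\<Sum>a\<in>I. v a * x a) = 0})"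
  have cont: "continuous_on A (\<lambda>x::'i \<Rightarrow> real. x a)" for A and a :: 'i
    by (rule continuous_on_subset[OF continuous_on_product_coordinates subset_UNIV])
  have "compactin (product_topology (\<lambda>_. euclidean) UNIV) Kb"
    unfolding Kb_def compactin_PiE by auto
  then have compK: "compact Kb"
    by (simp add: euclidean_product_topology)
  have "closed {x::'i \<Rightarrow> real. (\<Sum>a\<in>I. (x a)\<^sup>2) = 1}"
    by (intro closed_Collect_eq continuous_intros cont)
  moreover have "closed {x::'i \<Rightarrow> real. (\<Sum>a\<in>I. v a * x a) = 0}" for v
    by (intro closed_Collect_eq continuous_intros cont)
  ultimately have "closed C"
    unfolding C_def by (intro closed_Int closed_INT) auto
  with compK have compKC: "compact (Kb \<inter> C)"
    by (rule compact_Int_closed)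
  have normalized: "(\<lambda>a. y a / sqrt (\<Sum>a\<in>I. (y a)\<^sup>2)) \<in> Kb \<inter> C"
    if y: "\<forall>a. a \<notin> I \<longrightarrow> y a = 0" "(\<Sum>a\<in>I. (y a)\<^sup>2) > 0" "\<forall>v\<in>V. (\<Sum>a\<in>I. v a * y a) = 0" for y
  proof -
    define N where "N = (\<Sum>a\<in>I. (y a)\<^sup>2)"
    have Np: "N > 0" using y(2) N_def by simp
    have "\<bar>y a / sqrt N\<bar> \<le> 1" if "a \<in> I" for a
    proof -
      have "(y a)\<^sup>2 \<le> N" unfolding N_def using that I
        by (intro member_le_sum) auto
      then have "\<bar>y a\<bar> \<le> sqrt N" by (simp add: real_le_rsqrt)
      with Np show ?thesis by simp
    qed
    then have "(\<lambda>a. y a / sqrt N) \<in> Kb"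
      unfolding Kb_def
    proof (intro PiE_I)
      fix a assume a: "\<And>a. a \<in> I \<Longrightarrow> \<bar>y a / sqrt N\<bar> \<le> 1"
      show "y a / sqrt N \<in> (if a \<in> I then {-1..1} else {0})"
        using a[of a] y(1) unfolding abs_le_iff by auto
    qed simp
    moreover have "(\<Sum>a\<in>I. (y a / sqrt N)\<^sup>2) = 1"
      using Np by (simp add: power_divide flip: sum_divide_distrib N_def)
    moreover have "(\<Sum>a\<in>I. v a * (y a / sqrt N)) = 0" if "v \<in> V" for v
      using y(3) that by (simp flip: sum_divide_distrib)
    ultimately show ?thesis unfolding C_def N_def by auto
  qed
  have "continuous_on (Kb \<inter> C) F"
    unfolding F_def by (intro continuous_intros cont)
  then obtain x where x: "x \<in> Kb \<inter> C" and xmax: "\<And>y. y \<in> Kb \<inter> C \<Longrightarrow> F y \<le> F x"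
    using continuous_attains_sup[OF compKC, of F] normalized[OF z] by blast
  have x0: "x a = 0" if "a \<notin> I" for a
  proof -
    have "x a \<in> (if a \<in> I then {-1..1::real} else {0})"
      using x unfolding Kb_def by (blast dest: PiE_mem)
    with that show ?thesis by simp
  qed
  have "F y \<le> F x * (\<Sum>a\<in>I. (y a)\<^sup>2)"
    if y: "\<forall>a. a \<notin> I \<longrightarrow> y a = 0" "\<forall>v\<in>V. (\<Sum>a\<in>I. v a * y a) = 0" for y
  proof (cases "(\<Sum>a\<in>I. (y a)\<^sup>2) = 0")
    case True
    then have "\<forall>a\<in>I. y a = 0" using I by (simp add: sum_nonneg_eq_0_iff)
    then show ?thesis unfolding F_def by simp
  next
    case False
    define N where "N = (\<Sum>a\<in>I. (y a)\<^sup>2)"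
    have Np: "N > 0" using False unfolding N_def by (simp add: sum_nonneg less_le)
    have "F (\<lambda>a. y a / sqrt N) \<le> F x"
      unfolding N_def using y Np by (intro xmax normalized) (auto simp: N_def)
    moreover have "F (\<lambda>a. y a / sqrt N) = F y / N"
      using Np unfolding F_def by (simp add: sum_divide_distrib)
    ultimately show ?thesis using Np unfolding N_def[symmetric] by (simp add: field_simps)
  qed
  moreover have "(\<Sum>a\<in>I. (x a)\<^sup>2) = 1" "\<forall>v\<in>V. (\<Sum>a\<in>I. v a * x a) = 0"
    using x unfolding C_def by auto
  ultimately show ?thesis using x0 unfolding F_def by blast
qed

text \<open>Dividing by \<open>t\<close> and letting \<open>t\<close> tend to 0 from both sides
  gives the claim; the single value \<open>t = A / C\<close> with \<open>C\<close> positive and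
  above \<open>B\<close> already does it.\<close>

lemma linear_le_quadratic_imp_zero:
  fixes A B :: real
  assumes "\<And>t. t * A \<le> t\<^sup>2 * B"
  shows "A = 0"
proof (rule ccontr)
  assume "A \<noteq> 0"
  define C where "C = \<bar>B\<bar> + 1"
  have C: "C > 0" "B < C" unfolding C_def by auto
  have "(A / C) * A \<le> (A / C)\<^sup>2 * B" using assms .
  also have "\<dots> < (A / C)\<^sup>2 * C" using C \<open>A \<noteq> 0\<close> by (intro mult_strict_left_mono) auto
  also have "\<dots> = (A / C) * A" using C by (simp add: power2_eq_square)
  finally show False by simp
qed

text \<open>By symmetry of \<open>H\<close>, the orthogonal complement of a set of eigenvectors is
  invariant under \<open>H\<close>, so a maximizer of the Rayleigh quotient on it is again an
  eigenvector. The vector \<open>z\<close> certifies that the complement is not trivial.\<close>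

lemma new_eigenvector:
  fixes H :: "'i \<Rightarrow> 'i \<Rightarrow> real" and V :: "('i \<Rightarrow> real) set"
  assumes I: "finite I" and sym: "\<And>a b. a \<in> I \<Longrightarrow> b \<in> I \<Longrightarrow> H a b = H b a"
    and eig: "\<And>v. v \<in> V \<Longrightarrow> \<exists>c. \<forall>a\<in>I. (\<Sum>b\<in>I. H a b * v b) = c * v a"
    and z: "\<forall>a. a \<notin> I \<longrightarrow> z a = 0" "(\<Sum>a\<in>I. (z a)\<^sup>2) > 0" "\<forall>v\<in>V. (\<Sum>a\<in>I. v a * z a) = 0"
  shows "\<exists>x c. (\<forall>a. a \<notin> I \<longrightarrow> x a = 0) \<and> (\<Sum>a\<in>I. (x a)\<^sup>2) = 1 \<and>
    (\<forall>v\<in>V. (\<Sum>a\<in>I. v a * x a) = 0) \<and> (\<forall>a\<in>I. (\<Sum>b\<in>I. H a b * x b) = c * x a)"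
proof -
  obtain x where x0: "\<forall>a. a \<notin> I \<longrightarrow> x a = 0" and x1: "(\<Sum>a\<in>I. (x a)\<^sup>2) = 1"
    and xV: "\<forall>v\<in>V. (\<Sum>a\<in>I. v a * x a) = 0"
    and max: "\<forall>y. (\<forall>a. a \<notin> I \<longrightarrow> y a = 0) \<longrightarrow> (\<forall>v\<in>V. (\<Sum>a\<in>I. v a * y a) = 0) \<longrightarrow>
       (\<Sum>a\<in>I. \<Sum>b\<in>I. H a b * y a * y b) \<le> (\<Sum>a\<in>I. \<Sum>b\<in>I. H a b * x a * x b) * (\<Sum>a\<in>I. (y a)\<^sup>2)"
    using exists_ratio_maximizer[of I z V H, OF I z] by (elim exE conjE)
  have x: "\<And>a. a \<notin> I \<Longrightarrow> x a = 0" "(\<Sum>a\<in>I. (x a)\<^sup>2) = 1"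
    "\<And>v. v \<in> V \<Longrightarrow> (\<Sum>a\<in>I. v a * x a) = 0"
    using x0 x1 xV by auto
  define F where "F = (\<lambda>x::'i \<Rightarrow> real. \<Sum>a\<in>I. \<Sum>b\<in>I. H a b * x a * x b)"
  define c where "c = F x"
  define y where "y = (\<lambda>a. if a \<in> I then (\<Sum>b\<in>I. H a b * x b) - c * x a else 0)"
  have swap: "(\<Sum>a\<in>I. \<Sum>b\<in>I. H a b * g a * h b) = (\<Sum>a\<in>I. \<Sum>b\<in>I. H a b * h a * g b)" for g h
    by (subst sum.swap) (intro sum.cong refl, simp add: sym mult_ac)
  \<comment> \<open>Invariance of the complement: the residual \<open>y\<close> is orthogonal to
    \<open>V\<close>, which makes \<open>x + t y\<close> an admissible competitor for every
    \<open>t\<close>.\<close>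
  have yorth: "(\<Sum>a\<in>I. v a * y a) = 0" if v: "v \<in> V" for v
  proof -
    obtain cv where cv: "\<forall>a\<in>I. (\<Sum>b\<in>I. H a b * v b) = cv * v a" using eig[OF v] by blast
    have "(\<Sum>a\<in>I. v a * y a) = (\<Sum>a\<in>I. \<Sum>b\<in>I. H a b * v a * x b) - c * (\<Sum>a\<in>I. v a * x a)"
      unfolding y_def by (simp add: algebra_simps sum_distrib_left sum_subtractf)
    also have "\<dots> = (\<Sum>a\<in>I. x a * (\<Sum>b\<in>I. H a b * v b))"
      unfolding swap[of v x] using x(3)[OF v] by (simp add: sum_distrib_left mult_ac)
    also have "\<dots> = cv * (\<Sum>a\<in>I. v a * x a)"
      using cv by (simp add: sum_distrib_left mult_ac)
    finally show ?thesis using x(3)[OF v] by simp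
  qed
  have cross: "(\<Sum>a\<in>I. \<Sum>b\<in>I. H a b * y a * x b) = (\<Sum>a\<in>I. (y a)\<^sup>2) + c * (\<Sum>a\<in>I. x a * y a)"
    unfolding sum_distrib_left sum.distrib[symmetric]
  proof (intro sum.cong refl)
    fix a assume "a \<in> I"
    then have "(\<Sum>b\<in>I. H a b * x b) = y a + c * x a" by (simp add: y_def)
    then have "y a * (\<Sum>b\<in>I. H a b * x b) = (y a)\<^sup>2 + c * (x a * y a)"
      by (simp add: algebra_simps power2_eq_square)
    then show "(\<Sum>b\<in>I. H a b * y a * x b) = (y a)\<^sup>2 + c * (x a * y a)"
      by (simp add: sum_distrib_left mult_ac)
  qed
  \<comment> \<open>Moving the maximizer \<open>x\<close> in the direction of the residual \<open>y = H x - c x\<close> changes the form to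
    first order by \<open>2 t |y|\<^sup>2\<close>, so \<open>y = 0\<close>.\<close>
  have "t * (2 * (\<Sum>a\<in>I. (y a)\<^sup>2)) \<le> t\<^sup>2 * (c * (\<Sum>a\<in>I. (y a)\<^sup>2) - F y)" for t
  proof -
    have "F (\<lambda>a. x a + t * y a) \<le> c * (\<Sum>a\<in>I. (x a + t * y a)\<^sup>2)"
      unfolding F_def c_def
    proof (rule max[rule_format])
      fix v assume v: "v \<in> V"
      have "(\<Sum>a\<in>I. v a * (x a + t * y a)) = (\<Sum>a\<in>I. v a * x a) + t * (\<Sum>a\<in>I. v a * y a)"
        by (simp add: sum.distrib sum_distrib_left algebra_simps)
      then show "(\<Sum>a\<in>I. v a * (x a + t * y a)) = 0" using x(3) yorth v by simp
    qed (simp add: x(1) y_def)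
    moreover have "F (\<lambda>a. x a + t * y a) = c + 2 * t * (\<Sum>a\<in>I. \<Sum>b\<in>I. H a b * y a * x b) + t\<^sup>2 * F y"
    proof -
      have "F (\<lambda>a. x a + t * y a) = F x + t * (\<Sum>a\<in>I. \<Sum>b\<in>I. H a b * x a * y b)
         + t * (\<Sum>a\<in>I. \<Sum>b\<in>I. H a b * y a * x b) + t\<^sup>2 * F y"
        unfolding F_def sum_distrib_left sum.distrib[symmetric]
        by (intro sum.cong refl) (simp add: algebra_simps power2_eq_square)
      then show ?thesis using swap[of x y] c_def by simp
    qed
    moreover have "(\<Sum>a\<in>I. (x a + t * y a)\<^sup>2) = 1 + 2 * t * (\<Sum>a\<in>I. x a * y a) + t\<^sup>2 * (\<Sum>a\<in>I. (y a)\<^sup>2)"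
    proof -
      have "(\<Sum>a\<in>I. (x a + t * y a)\<^sup>2) = (\<Sum>a\<in>I. (x a)\<^sup>2) + 2 * t * (\<Sum>a\<in>I. x a * y a) + t\<^sup>2 * (\<Sum>a\<in>I. (y a)\<^sup>2)"
        unfolding sum_distrib_left sum.distrib[symmetric]
        by (intro sum.cong refl) (simp add: algebra_simps power2_eq_square)
      then show ?thesis using x(2) by simp
    qed
    ultimately show ?thesis unfolding cross by (simp add: algebra_simps)
  qed
  then have "2 * (\<Sum>a\<in>I. (y a)\<^sup>2) = 0" by (rule linear_le_quadratic_imp_zero)
  then have "\<forall>a\<in>I. y a = 0" using I by (simp add: sum_nonneg_eq_0_iff)
  then have "\<forall>a\<in>I. (\<Sum>b\<in>I. H a b * x b) = c * x a"
    by (simp add: y_def)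
  with x0 x1 xV show ?thesis by (intro exI[of _ x] exI[of _ c] conjI)
qed

text \<open>Matrices are functions of two indices ranging over a finite set \<open>I\<close>; entries outside \<open>I\<close>
  are ignored.\<close>

definition sym_on :: "'i set \<Rightarrow> ('i \<Rightarrow> 'i \<Rightarrow> real) \<Rightarrow> bool" where
  "sym_on I H \<longleftrightarrow> (\<forall>a\<in>I. \<forall>b\<in>I. H a b = H b a)"

text \<open>Eigenvectors are indexed by the same set as coordinates, \<open>u i a\<close> being
  coordinate \<open>a\<close> of the \<open>i\<close>-th one, so \<open>u\<close> is an orthogonal
  matrix. The first clause is orthonormality, the second is completeness, in the form that
  Parseval's identity uses.\<close>

definition eigenbasis :: "'i set \<Rightarrow> ('i \<Rightarrow> 'i \<Rightarrow> real) \<Rightarrow> ('i \<Rightarrow> real) \<Rightarrow> ('i \<Rightarrow> 'i \<Rightarrow> real) \<Rightarrow> bool" where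
  "eigenbasis I H l u \<longleftrightarrow>
     (\<forall>i\<in>I. \<forall>j\<in>I. (\<Sum>a\<in>I. u i a * u j a) = (if i = j then 1 else 0)) \<and>
     (\<forall>a\<in>I. \<forall>b\<in>I. (\<Sum>i\<in>I. u i a * u i b) = (if a = b then 1 else 0)) \<and>
     (\<forall>i\<in>I. \<forall>a\<in>I. (\<Sum>b\<in>I. H a b * u i b) = l i * u i a)"

text \<open>An orthonormal set of eigenvectors of maximal size is complete: otherwise the projection
  \<open>pr\<close> of some coordinate vector to its complement is nonzero, and
  \<open>new_eigenvector\<close> enlarges the set. Bessel's inequality bounds the size, so a maximum
  exists.\<close>

theorem spectral_theorem:
  fixes H :: "'i \<Rightarrow> 'i \<Rightarrow> real"
  assumes I: "finite I" and sym: "sym_on I H"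
  shows "\<exists>l u. eigenbasis I H l u"
proof -
  define good where "good = (\<lambda>V::('i \<Rightarrow> real) set. finite V \<and> (\<forall>v\<in>V. \<forall>a. a \<notin> I \<longrightarrow> v a = 0) \<and>
     (\<forall>v\<in>V. \<forall>w\<in>V. (\<Sum>a\<in>I. v a * w a) = (if v = w then 1 else 0)) \<and>
     (\<forall>v\<in>V. \<exists>c. \<forall>a\<in>I. (\<Sum>b\<in>I. H a b * v b) = c * v a))"
  define pr where "pr = (\<lambda>V (x::'i \<Rightarrow> real) a. if a \<in> I then x a - (\<Sum>v\<in>V. (\<Sum>b\<in>I. v b * x b) * v a) else (0::real))"
  have prorth: "(\<Sum>a\<in>I. w a * pr V x a) = 0" if "good V" "w \<in> V" for V x w
  proof -
    have "(\<Sum>a\<in>I. w a * pr V x a) = (\<Sum>a\<in>I. w a * x a) - (\<Sum>a\<in>I. \<Sum>v\<in>V. (\<Sum>b\<in>I. v b * x b) * (w a * v a))"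
      unfolding pr_def by (simp add: right_diff_distrib sum_subtractf sum_distrib_left mult_ac)
    also have "(\<Sum>a\<in>I. \<Sum>v\<in>V. (\<Sum>b\<in>I. v b * x b) * (w a * v a)) = (\<Sum>v\<in>V. (\<Sum>b\<in>I. v b * x b) * (\<Sum>a\<in>I. w a * v a))"
      by (subst sum.swap) (simp add: sum_distrib_left)
    also have "\<dots> = (\<Sum>v\<in>V. if w = v then (\<Sum>b\<in>I. v b * x b) else 0)"
      using that unfolding good_def by (intro sum.cong) auto
    also have "\<dots> = (\<Sum>b\<in>I. w b * x b)"
      using that unfolding good_def by simp
    finally show ?thesis by simp
  qed
  have e_ip: "(\<Sum>b\<in>I. v b * (if b = a then 1 else 0)) = (v a :: real)" if "a \<in> I" for v a
    using that I by (simp add: sum.delta if_distrib cong: if_cong)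
  have normsum: "(\<Sum>a\<in>I. \<Sum>v\<in>V. (v a)\<^sup>2) = real (card V)" if "good V" for V
    using that by (subst sum.swap) (simp add: good_def power2_eq_square)
  have bessel: "card V \<le> card I" if V: "good V" for V
  proof -
    have "(\<Sum>v\<in>V. (v a)\<^sup>2) \<le> 1" if a: "a \<in> I" for a
    proof -
      let ?e = "\<lambda>b. if b = a then 1 else (0::real)"
      have "0 \<le> (\<Sum>b\<in>I. (pr V ?e b)\<^sup>2)" by (simp add: sum_nonneg)
      also have "\<dots> = (\<Sum>b\<in>I. (?e b - (\<Sum>v\<in>V. v a * v b)) * pr V ?e b)"
        by (intro sum.cong) (simp_all add: pr_def e_ip[OF a] power2_eq_square)
      also have "\<dots> = (\<Sum>b\<in>I. pr V ?e b * ?e b) - (\<Sum>v\<in>V. v a * (\<Sum>b\<in>I. v b * pr V ?e b))"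
        unfolding left_diff_distrib sum_subtractf sum_distrib_left sum_distrib_right
        by (subst (2) sum.swap) (simp add: mult_ac)
      also have "\<dots> = pr V ?e a"
        using prorth[OF V] by (simp add: e_ip[OF a])
      also have "\<dots> = 1 - (\<Sum>v\<in>V. (v a)\<^sup>2)"
        using a by (simp add: pr_def e_ip[OF a] power2_eq_square)
      finally show ?thesis by simp
    qed
    then have "(\<Sum>a\<in>I. \<Sum>v\<in>V. (v a)\<^sup>2) \<le> (\<Sum>a\<in>I. 1)" by (intro sum_mono) auto
    then show ?thesis unfolding normsum[OF V] by simp
  qed
  have "good {}" unfolding good_def by simp
  then obtain V where V: "good V" and Vmax: "\<And>W. good W \<Longrightarrow> card W \<le> card V"
    using ex_has_greatest_nat[of good "{}" card "Suc (card I)"] bessel by (metis less_Suc_eq_le)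
  have complete: "(\<Sum>v\<in>V. v a * v b) = (if a = b then 1 else 0)" if a: "a \<in> I" and b: "b \<in> I" for a b
  proof -
    let ?x = "pr V (\<lambda>b. if b = a then 1 else (0::real))"
    have "(\<Sum>a\<in>I. (?x a)\<^sup>2) = 0"
    proof (rule ccontr)
      assume "(\<Sum>a\<in>I. (?x a)\<^sup>2) \<noteq> 0"
      then have "(\<Sum>a\<in>I. (?x a)\<^sup>2) > 0" by (simp add: sum_nonneg less_le)
      then obtain x c where x0: "\<forall>a. a \<notin> I \<longrightarrow> x a = 0" and x1: "(\<Sum>a\<in>I. (x a)\<^sup>2) = 1"
        and xorth: "\<forall>v\<in>V. (\<Sum>a\<in>I. v a * x a) = 0"
        and xeig: "\<forall>a\<in>I. (\<Sum>b\<in>I. H a b * x b) = c * x a"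
      proof -
        have "\<exists>x c. (\<forall>a. a \<notin> I \<longrightarrow> x a = 0) \<and> (\<Sum>a\<in>I. (x a)\<^sup>2) = 1 \<and>
          (\<forall>v\<in>V. (\<Sum>a\<in>I. v a * x a) = 0) \<and> (\<forall>a\<in>I. (\<Sum>b\<in>I. H a b * x b) = c * x a)"
        proof (rule new_eigenvector[where z = ?x])
          show "H a b = H b a" if "a \<in> I" "b \<in> I" for a b using sym that by (simp add: sym_on_def)
          show "\<exists>c. \<forall>a\<in>I. (\<Sum>b\<in>I. H a b * v b) = c * v a" if "v \<in> V" for v
            using V that by (simp add: good_def)
          show "\<forall>v\<in>V. (\<Sum>a\<in>I. v a * ?x a) = 0" using prorth[OF V] by blast
          show "\<forall>a. a \<notin> I \<longrightarrow> ?x a = 0" by (simp add: pr_def)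
        qed fact+
        then show ?thesis using that by (elim exE conjE)
      qed
      have xV: "x \<notin> V" using x1 xorth by (auto simp: power2_eq_square)
      have "(\<Sum>a\<in>I. x a * x a) = 1" using x1 by (simp add: power2_eq_square)
      moreover have "(\<Sum>a\<in>I. x a * v a) = 0" if "v \<in> V" for v
        using xorth that by (simp add: mult.commute)
      ultimately have "good (insert x V)"
        using V x0 xorth xeig xV unfolding good_def by auto
      from Vmax[OF this] show False using xV V by (simp add: good_def)
    qed
    then have "?x b = 0" using I b by (simp add: sum_nonneg_eq_0_iff)
    then show ?thesis using b by (auto simp: pr_def e_ip[OF a])
  qed
  \<comment> \<open>Summing all squared entries in both orders shows that there are as many
    eigenvectors as coordinates, so they can be indexed by \<open>I\<close>.\<close>
  have "real (card V) = (\<Sum>a\<in>I. 1)"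
    unfolding normsum[OF V, symmetric] using complete by (intro sum.cong) (simp_all add: power2_eq_square)
  then have "card I = card V" by simp
  have Vp: "finite V" "\<forall>v\<in>V. \<forall>w\<in>V. (\<Sum>a\<in>I. v a * w a) = (if v = w then 1 else 0)"
    "\<forall>v\<in>V. \<exists>c. \<forall>a\<in>I. (\<Sum>b\<in>I. H a b * v b) = c * v a"
    using V by (simp_all add: good_def)
  obtain u where u: "bij_betw u I V"
    using finite_same_card_bij[OF I Vp(1) \<open>card I = card V\<close>] by (elim exE)
  from u have uV: "\<And>i. i \<in> I \<Longrightarrow> u i \<in> V" by (auto simp: bij_betw_def)
  have "\<forall>i\<in>I. \<exists>c. \<forall>a\<in>I. (\<Sum>b\<in>I. H a b * u i b) = c * u i a"
    using uV Vp(3) by simp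
  from bchoice[OF this] obtain l where l: "\<forall>i\<in>I. \<forall>a\<in>I. (\<Sum>b\<in>I. H a b * u i b) = l i * u i a"
    by (elim exE)
  have "(\<Sum>a\<in>I. u i a * u j a) = (if i = j then 1 else 0)" if "i \<in> I" "j \<in> I" for i j
  proof -
    have "u i = u j \<longleftrightarrow> i = j" using u that by (metis bij_betw_imp_inj_on inj_on_eq_iff)
    then show ?thesis using that uV Vp(2) by simp
  qed
  moreover have "(\<Sum>i\<in>I. u i a * u i b) = (if a = b then 1 else 0)" if "a \<in> I" "b \<in> I" for a b
    using complete[OF that] sum.reindex_bij_betw[OF u, of "\<lambda>v. v a * v b"] by simp
  ultimately have "eigenbasis I H l u" using l unfolding eigenbasis_def by simp
  then show ?thesis by (intro exI)
qed

section \<open>Traces of functions of symmetric matrices\<close>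

locale finite_index =
  fixes I :: "'i set"
  assumes finI: "finite I"
begin

definition ip :: "('i \<Rightarrow> real) \<Rightarrow> ('i \<Rightarrow> real) \<Rightarrow> real" where
  "ip x y = (\<Sum>a\<in>I. x a * y a)"

definition qform :: "('i \<Rightarrow> 'i \<Rightarrow> real) \<Rightarrow> ('i \<Rightarrow> real) \<Rightarrow> real" where
  "qform B v = (\<Sum>a\<in>I. \<Sum>b\<in>I. B a b * v a * v b)"

definition sq :: "('i \<Rightarrow> 'i \<Rightarrow> real) \<Rightarrow> 'i \<Rightarrow> 'i \<Rightarrow> real" where
  "sq B a b = (\<Sum>c\<in>I. B a c * B c b)"

definition psd :: "('i \<Rightarrow> 'i \<Rightarrow> real) \<Rightarrow> bool" where
  "psd B \<longleftrightarrow> sym_on I B \<and> (\<forall>v. 0 \<le> qform B v)"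

text \<open>An arbitrary but fixed spectral decomposition; the eigenvalues are chosen first, so that
  \<open>eu\<close> belongs to the same \<open>ev\<close>. By \<open>eigen_sum_unique\<close>,
  \<open>tr1\<close> of a symmetric matrix does not depend on the choice.\<close>

definition ev :: "('i \<Rightarrow> 'i \<Rightarrow> real) \<Rightarrow> 'i \<Rightarrow> real" where
  "ev H = (SOME l. \<exists>u. eigenbasis I H l u)"

definition eu :: "('i \<Rightarrow> 'i \<Rightarrow> real) \<Rightarrow> 'i \<Rightarrow> 'i \<Rightarrow> real" where
  "eu H = (SOME u. eigenbasis I H (ev H) u)"

text \<open>\<open>tr1 f Y\<close> is the trace of \<open>f(Y)\<close> and \<open>trf B f Y\<close> the trace of \<open>B f(Y)\<close>.\<close>

definition tr1 :: "(real \<Rightarrow> real) \<Rightarrow> ('i \<Rightarrow> 'i \<Rightarrow> real) \<Rightarrow> real" where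
  "tr1 f Y = (\<Sum>j\<in>I. f (ev Y j))"

definition trf :: "('i \<Rightarrow> 'i \<Rightarrow> real) \<Rightarrow> (real \<Rightarrow> real) \<Rightarrow> ('i \<Rightarrow> 'i \<Rightarrow> real) \<Rightarrow> real" where
  "trf B f Y = (\<Sum>j\<in>I. f (ev Y j) * qform B (eu Y j))"

text \<open>For symmetric \<open>Y\<close> and \<open>Z\<close> this matrix is doubly stochastic by
  Parseval, so a trace that involves only one of them is also a double sum against these
  weights.\<close>

definition wt :: "('i \<Rightarrow> 'i \<Rightarrow> real) \<Rightarrow> ('i \<Rightarrow> 'i \<Rightarrow> real) \<Rightarrow> 'i \<Rightarrow> 'i \<Rightarrow> real" where
  "wt Y Z i j = (ip (eu Y i) (eu Z j))\<^sup>2"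

lemma eigenbasis_ev: 
  assumes "sym_on I H" shows "eigenbasis I H (ev H) (eu H)"
proof -
  have "\<exists>l u. eigenbasis I H l u" by (rule spectral_theorem[OF finI assms])
  then have "\<exists>u. eigenbasis I H (ev H) u" unfolding ev_def by (rule someI_ex)
  then show ?thesis unfolding eu_def by (rule someI_ex)
qed

section \<open>Quadratic forms in an eigenbasis\<close>

lemma ip_commute: "ip x y = ip y x"
  by (simp add: ip_def mult.commute)

lemma parseval:
  assumes "eigenbasis I H l u"
  shows "(\<Sum>j\<in>I. (ip x (u j))\<^sup>2) = ip x x"
proof -
  have "(\<Sum>j\<in>I. (ip x (u j))\<^sup>2) = (\<Sum>j\<in>I. \<Sum>a\<in>I. \<Sum>b\<in>I. x a * x b * (u j a * u j b))"
    by (simp add: ip_def power2_eq_square sum_product mult_ac)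
  also have "\<dots> = (\<Sum>a\<in>I. \<Sum>j\<in>I. \<Sum>b\<in>I. x a * x b * (u j a * u j b))" by (rule sum.swap)
  also have "\<dots> = (\<Sum>a\<in>I. \<Sum>b\<in>I. x a * x b * (\<Sum>j\<in>I. u j a * u j b))"
    by (subst sum.swap) (simp add: sum_distrib_left)
  also have "\<dots> = (\<Sum>a\<in>I. \<Sum>b\<in>I. if a = b then x a * x b else 0)"
    using assms unfolding eigenbasis_def by (intro sum.cong refl) auto
  also have "\<dots> = ip x x" using finI by (simp add: ip_def)
  finally show ?thesis .
qed

lemma eigenbasis_entry:
  assumes "eigenbasis I H l u" "a \<in> I" "b \<in> I"
  shows "H a b = (\<Sum>i\<in>I. l i * u i a * u i b)"
proof -
  have "(\<Sum>i\<in>I. l i * u i a * u i b) = (\<Sum>i\<in>I. \<Sum>c\<in>I. H a c * (u i c * u i b))"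
  proof (intro sum.cong refl)
    fix i assume "i \<in> I"
    then have "(\<Sum>c\<in>I. H a c * u i c) = l i * u i a" using assms unfolding eigenbasis_def by blast
    then have "l i * u i a * u i b = (\<Sum>c\<in>I. H a c * u i c) * u i b" by simp
    then show "l i * u i a * u i b = (\<Sum>c\<in>I. H a c * (u i c * u i b))"
      unfolding sum_distrib_right mult.assoc .
  qed
  also have "\<dots> = (\<Sum>c\<in>I. H a c * (\<Sum>i\<in>I. u i c * u i b))"
    by (subst sum.swap) (simp add: sum_distrib_left)
  also have "\<dots> = (\<Sum>c\<in>I. if c = b then H a c else 0)"
    using assms unfolding eigenbasis_def by (intro sum.cong refl) auto
  finally show ?thesis using assms(3) finI by simp
qed

lemma qform_eigen:
  assumes "eigenbasis I H l u"
  shows "qform H v = (\<Sum>i\<in>I. l i * (ip (u i) v)\<^sup>2)"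
proof -
  have "qform H v = (\<Sum>a\<in>I. \<Sum>b\<in>I. \<Sum>i\<in>I. l i * ((u i a * v a) * (u i b * v b)))"
    unfolding qform_def
    by (intro sum.cong refl) (simp add: eigenbasis_entry[OF assms] sum_distrib_left sum_distrib_right mult_ac)
  also have "\<dots> = (\<Sum>a\<in>I. \<Sum>i\<in>I. \<Sum>b\<in>I. l i * ((u i a * v a) * (u i b * v b)))"
    by (intro sum.cong refl sum.swap)
  also have "\<dots> = (\<Sum>i\<in>I. \<Sum>a\<in>I. \<Sum>b\<in>I. l i * ((u i a * v a) * (u i b * v b)))"
    by (rule sum.swap)
  also have "\<dots> = (\<Sum>i\<in>I. l i * (ip (u i) v)\<^sup>2)"
    unfolding ip_def power2_eq_square unfolding sum_product unfolding sum_distrib_left by (rule refl)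
  finally show ?thesis .
qed

lemma qform_sq:
  assumes "sym_on I D"
  shows "qform (sq D) v = ip (\<lambda>c. \<Sum>b\<in>I. D c b * v b) (\<lambda>c. \<Sum>b\<in>I. D c b * v b)"
proof -
  have "qform (sq D) v = (\<Sum>a\<in>I. \<Sum>b\<in>I. \<Sum>c\<in>I. (D a c * v a) * (D c b * v b))"
    unfolding qform_def sq_def by (simp add: sum_distrib_left sum_distrib_right mult_ac)
  also have "\<dots> = (\<Sum>a\<in>I. \<Sum>c\<in>I. \<Sum>b\<in>I. (D a c * v a) * (D c b * v b))"
    by (intro sum.cong refl sum.swap)
  also have "\<dots> = (\<Sum>c\<in>I. \<Sum>a\<in>I. \<Sum>b\<in>I. (D a c * v a) * (D c b * v b))"
    by (rule sum.swap)
  also have "\<dots> = (\<Sum>c\<in>I. \<Sum>a\<in>I. \<Sum>b\<in>I. (D c a * v a) * (D c b * v b))"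
    using assms unfolding sym_on_def by (intro sum.cong refl) auto
  finally show ?thesis by (simp add: ip_def sum_product)
qed

lemma ip_matrix_eigen:
  assumes "eigenbasis I Y l u" "sym_on I Y" "i \<in> I"
  shows "ip (u i) (\<lambda>a. \<Sum>b\<in>I. Y a b * v b) = l i * ip (u i) v"
proof -
  have "ip (u i) (\<lambda>a. \<Sum>b\<in>I. Y a b * v b) = (\<Sum>b\<in>I. (\<Sum>a\<in>I. Y b a * u i a) * v b)"
  proof -
    have "ip (u i) (\<lambda>a. \<Sum>b\<in>I. Y a b * v b) = (\<Sum>b\<in>I. \<Sum>a\<in>I. u i a * (Y a b * v b))"
      unfolding ip_def sum_distrib_left by (rule sum.swap)
    also have "\<dots> = (\<Sum>b\<in>I. \<Sum>a\<in>I. Y b a * u i a * v b)"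
      using assms(2) unfolding sym_on_def by (intro sum.cong refl) auto
    finally show ?thesis by (simp add: sum_distrib_right)
  qed
  also have "\<dots> = (\<Sum>b\<in>I. l i * u i b * v b)"
    using assms(1,3) unfolding eigenbasis_def by (intro sum.cong refl) auto
  finally show ?thesis by (simp add: ip_def sum_distrib_left mult_ac)
qed

text \<open>By Parseval the weights at \<open>v j\<close> sum to 1, so \<open>m j\<close> can be
  distributed over them. Eigenvalue differences thus appear although the eigenbasis of
  \<open>Y - Z\<close> itself never enters.\<close>

lemma qform_diff_eigen:
  assumes Y: "eigenbasis I Y l u" and Z: "eigenbasis I Z m v" and j: "j \<in> I"
  shows "qform (\<lambda>a b. Y a b - Z a b) (v j) = (\<Sum>i\<in>I. (l i - m j) * (ip (u i) (v j))\<^sup>2)"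
proof -
  have one: "ip (v k) (v j) = (if k = j then 1 else 0)" if "k \<in> I" for k
    using Z j that unfolding eigenbasis_def ip_def by simp
  have "qform (\<lambda>a b. Y a b - Z a b) (v j) = qform Y (v j) - qform Z (v j)"
    by (simp add: qform_def algebra_simps sum_subtractf)
  also have "qform Z (v j) = (\<Sum>k\<in>I. if k = j then m k else 0)"
    unfolding qform_eigen[OF Z] by (intro sum.cong refl) (simp add: one)
  also have "\<dots> = m j" using finI j by simp
  also have "m j = m j * (\<Sum>i\<in>I. (ip (u i) (v j))\<^sup>2)"
    using parseval[OF Y, of "v j"] one[OF j] by (simp add: ip_commute)
  finally show ?thesis
    by (simp add: qform_eigen[OF Y] left_diff_distrib sum_subtractf sum_distrib_left)
qed

lemma sym_on_diff: "sym_on I Y \<Longrightarrow> sym_on I Z \<Longrightarrow> sym_on I (\<lambda>a b. Y a b - Z a b)"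
  by (simp add: sym_on_def)

text \<open>Between the two bases \<open>Y - Z\<close> has the entries
  \<open>(l i - m j) * ip (u i) (v j)\<close>, and the form of its square at \<open>v j\<close> is
  the squared length of the image of \<open>v j\<close>, computed by Parseval in the basis
  \<open>u\<close>. A third power would bring in a sum over further intermediate vectors, so this
  calculus stops at second order.\<close>

lemma qform_sq_diff_eigen:
  assumes Y: "eigenbasis I Y l u" "sym_on I Y" and Z: "eigenbasis I Z m v" "sym_on I Z" and j: "j \<in> I"
  shows "qform (sq (\<lambda>a b. Y a b - Z a b)) (v j) = (\<Sum>i\<in>I. (l i - m j)\<^sup>2 * (ip (u i) (v j))\<^sup>2)"
proof -
  define x where "x = (\<lambda>c. \<Sum>b\<in>I. (Y c b - Z c b) * v j b)"
  have "ip x (u i) = (l i - m j) * ip (u i) (v j)" if i: "i \<in> I" for i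
  proof -
    have "x c = (\<Sum>b\<in>I. Y c b * v j b) - m j * v j c" if "c \<in> I" for c
      using Z(1) j that unfolding x_def eigenbasis_def by (simp add: left_diff_distrib sum_subtractf)
    then have "ip x (u i) = (\<Sum>c\<in>I. u i c * (\<Sum>b\<in>I. Y c b * v j b) - m j * (u i c * v j c))"
      unfolding ip_def by (intro sum.cong refl) (simp add: left_diff_distrib right_diff_distrib mult_ac)
    then have "ip x (u i) = ip (u i) (\<lambda>c. \<Sum>b\<in>I. Y c b * v j b) - m j * ip (u i) (v j)"
      unfolding ip_def sum_subtractf sum_distrib_left .
    then show ?thesis unfolding ip_matrix_eigen[OF Y i] by (simp add: algebra_simps)
  qed
  then have "ip x x = (\<Sum>i\<in>I. (l i - m j)\<^sup>2 * (ip (u i) (v j))\<^sup>2)"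
    using parseval[OF Y(1), of x] by (simp add: power_mult_distrib cong: sum.cong)
  then show ?thesis
    using qform_sq[OF sym_on_diff[OF Y(2) Z(2)]] by (simp add: x_def)
qed

lemma eigenbasis_sq:
  assumes "eigenbasis I H l u"
  shows "eigenbasis I (sq H) (\<lambda>i. (l i)\<^sup>2) u"
proof -
  have "(\<Sum>b\<in>I. sq H a b * u i b) = (l i)\<^sup>2 * u i a" if i: "i \<in> I" and a: "a \<in> I" for i a
  proof -
    have e: "(\<Sum>b\<in>I. H c b * u i b) = l i * u i c" if "c \<in> I" for c
      using assms i that unfolding eigenbasis_def by blast
    have "(\<Sum>b\<in>I. sq H a b * u i b) = (\<Sum>c\<in>I. H a c * (\<Sum>b\<in>I. H c b * u i b))"
      unfolding sq_def sum_distrib_left sum_distrib_right by (subst sum.swap) (simp add: mult_ac)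
    also have "\<dots> = l i * (\<Sum>c\<in>I. H a c * u i c)"
      by (simp add: e sum_distrib_left mult_ac)
    finally show ?thesis using e[OF a] by (simp add: power2_eq_square)
  qed
  then show ?thesis using assms unfolding eigenbasis_def by blast
qed

lemma sym_on_sq: "sym_on I H \<Longrightarrow> sym_on I (sq H)"
  unfolding sym_on_def sq_def by (auto intro!: sum.cong simp: mult.commute)

lemma psd_sq: assumes "sym_on I H" shows "psd (sq H)"
  unfolding psd_def using assms by (simp add: qform_sq sym_on_sq ip_def sum_nonneg)

text \<open>The overlap of an eigenvector from each basis vanishes unless the eigenvalues agree, so
  \<open>f (l i)\<close> may be exchanged for \<open>f (l' j)\<close> against the squared overlaps,
  whose row and column sums are 1.\<close>

lemma eigen_sum_unique:
  assumes "eigenbasis I H l u" "eigenbasis I H l' u'" "sym_on I H"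
  shows "(\<Sum>i\<in>I. f (l i)) = (\<Sum>i\<in>I. f (l' i) :: real)"
proof -
  have eq: "f (l i) * (ip (u i) (u' j))\<^sup>2 = f (l' j) * (ip (u i) (u' j))\<^sup>2" if i: "i \<in> I" and j: "j \<in> I" for i j
  proof -
    have "l i * ip (u i) (u' j) = ip (u i) (\<lambda>a. \<Sum>b\<in>I. H a b * u' j b)"
      using ip_matrix_eigen[OF assms(1,3) i] by simp
    also have "\<dots> = (\<Sum>a\<in>I. u i a * (l' j * u' j a))"
      unfolding ip_def using assms(2) j unfolding eigenbasis_def by (intro sum.cong) auto
    also have "\<dots> = l' j * ip (u i) (u' j)" by (simp add: ip_def sum_distrib_left mult_ac)
    finally show ?thesis by auto
  qed
  have one: "ip (u i) (u i) = 1" "ip (u' i) (u' i) = 1" if "i \<in> I" for i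
    using assms that unfolding eigenbasis_def ip_def by simp_all
  have "(\<Sum>i\<in>I. f (l i)) = (\<Sum>i\<in>I. \<Sum>j\<in>I. f (l i) * (ip (u i) (u' j))\<^sup>2)"
    by (simp add: one parseval[OF assms(2)] flip: sum_distrib_left)
  also have "\<dots> = (\<Sum>i\<in>I. \<Sum>j\<in>I. f (l' j) * (ip (u' j) (u i))\<^sup>2)"
    by (intro sum.cong refl) (simp add: eq ip_commute)
  also have "\<dots> = (\<Sum>j\<in>I. \<Sum>i\<in>I. f (l' j) * (ip (u' j) (u i))\<^sup>2)" by (rule sum.swap)
  also have "\<dots> = (\<Sum>j\<in>I. f (l' j))"
    by (simp add: one parseval[OF assms(1)] flip: sum_distrib_left)
  finally show ?thesis .
qed

lemma tr1_eq:
  assumes "eigenbasis I H l u" "sym_on I H"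
  shows "tr1 f H = (\<Sum>i\<in>I. f (l i))"
  unfolding tr1_def by (rule eigen_sum_unique[OF eigenbasis_ev assms(1,2)]) (rule assms)

lemma tr1_sq:
  assumes "sym_on I H" shows "tr1 f (sq H) = tr1 (\<lambda>x. f (x\<^sup>2)) H"
  using tr1_eq[OF eigenbasis_sq[OF eigenbasis_ev[OF assms]] sym_on_sq[OF assms], of f] by (simp add: tr1_def)

section \<open>Traces as double sums over pairs of eigenvalues\<close>

lemma wt_nonneg: "0 \<le> wt Y Z i j" by (simp add: wt_def)

lemma wt_sum_right: 
  assumes "sym_on I Y" "sym_on I Z" "i \<in> I" shows "(\<Sum>j\<in>I. wt Y Z i j) = 1"
  using parseval[OF eigenbasis_ev[OF assms(2)], of "eu Y i"] eigenbasis_ev[OF assms(1)] assms(3)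
  unfolding wt_def by (simp add: eigenbasis_def ip_def)

lemma wt_commute: "wt Y Z i j = wt Z Y j i"
  by (simp add: wt_def ip_commute)

lemma wt_sum_left:
  assumes "sym_on I Y" "sym_on I Z" "j \<in> I" shows "(\<Sum>i\<in>I. wt Y Z i j) = 1"
  using wt_sum_right[OF assms(2,1,3)] by (simp add: wt_commute)

lemma tr1_wt_left:
  assumes "sym_on I Y" "sym_on I Z"
  shows "tr1 f Y = (\<Sum>i\<in>I. \<Sum>j\<in>I. f (ev Y i) * wt Y Z i j)"
  by (simp add: tr1_def wt_sum_right[OF assms] flip: sum_distrib_left)

lemma tr1_wt_right:
  assumes "sym_on I Y" "sym_on I Z"
  shows "tr1 f Z = (\<Sum>i\<in>I. \<Sum>j\<in>I. f (ev Z j) * wt Y Z i j)"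
  by (subst sum.swap) (simp add: tr1_def wt_sum_left[OF assms] flip: sum_distrib_left)

lemma trf_wt:
  assumes "sym_on I B" 
  shows "trf B f Y = (\<Sum>i\<in>I. \<Sum>j\<in>I. ev B i * f (ev Y j) * wt B Y i j)"
proof -
  have "trf B f Y = (\<Sum>j\<in>I. \<Sum>i\<in>I. ev B i * f (ev Y j) * wt B Y i j)"
    unfolding trf_def qform_eigen[OF eigenbasis_ev[OF assms]] wt_def
    by (simp add: sum_distrib_left mult_ac)
  then show ?thesis by (subst sum.swap)
qed

lemma trf_sq_wt:
  assumes "sym_on I B" 
  shows "trf (sq B) f Y = (\<Sum>i\<in>I. \<Sum>j\<in>I. (ev B i)\<^sup>2 * f (ev Y j) * wt B Y i j)"
proof -
  have "trf (sq B) f Y = (\<Sum>j\<in>I. \<Sum>i\<in>I. (ev B i)\<^sup>2 * f (ev Y j) * wt B Y i j)"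
    unfolding trf_def qform_eigen[OF eigenbasis_sq[OF eigenbasis_ev[OF assms]]] wt_def
    by (simp add: sum_distrib_left mult_ac)
  then show ?thesis by (subst sum.swap)
qed

lemma trf_diff_right:
  assumes "sym_on I Y" "sym_on I Z" 
  shows "trf (\<lambda>a b. Y a b - Z a b) f Z = (\<Sum>i\<in>I. \<Sum>j\<in>I. (ev Y i - ev Z j) * f (ev Z j) * wt Y Z i j)"
proof -
  have "trf (\<lambda>a b. Y a b - Z a b) f Z = (\<Sum>j\<in>I. \<Sum>i\<in>I. (ev Y i - ev Z j) * f (ev Z j) * wt Y Z i j)"
    unfolding trf_def wt_def
    by (intro sum.cong refl)
      (simp add: qform_diff_eigen[OF eigenbasis_ev[OF assms(1)] eigenbasis_ev[OF assms(2)]] sum_distrib_left mult_ac)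
  then show ?thesis by (subst sum.swap)
qed

lemma trf_sq_diff_right:
  assumes "sym_on I Y" "sym_on I Z" 
  shows "trf (sq (\<lambda>a b. Y a b - Z a b)) f Z = (\<Sum>i\<in>I. \<Sum>j\<in>I. (ev Y i - ev Z j)\<^sup>2 * f (ev Z j) * wt Y Z i j)"
proof -
  have "trf (sq (\<lambda>a b. Y a b - Z a b)) f Z = (\<Sum>j\<in>I. \<Sum>i\<in>I. (ev Y i - ev Z j)\<^sup>2 * f (ev Z j) * wt Y Z i j)"
    unfolding trf_def wt_def
    by (intro sum.cong refl)
      (simp add: qform_sq_diff_eigen[OF eigenbasis_ev[OF assms(1)] assms(1) eigenbasis_ev[OF assms(2)] assms(2)] sum_distrib_left mult_ac)
  then show ?thesis by (subst sum.swap)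
qed

lemma trf_uminus: "trf (\<lambda>a b. - B a b) f Y = - trf B f Y"
  by (simp add: trf_def qform_def sum_negf)

lemma trf_diff_left:
  assumes "sym_on I Y" "sym_on I Z" 
  shows "trf (\<lambda>a b. Y a b - Z a b) f Y = (\<Sum>i\<in>I. \<Sum>j\<in>I. (ev Y i - ev Z j) * f (ev Y i) * wt Y Z i j)"
proof -
  have "trf (\<lambda>a b. Y a b - Z a b) f Y = - trf (\<lambda>a b. Z a b - Y a b) f Y"
    using trf_uminus[of "\<lambda>a b. Z a b - Y a b" f Y] by simp
  also have "\<dots> = - (\<Sum>j\<in>I. \<Sum>i\<in>I. (ev Z j - ev Y i) * f (ev Y i) * wt Y Z i j)"
    by (simp add: trf_diff_right[OF assms(2,1)] wt_commute[of Y Z])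
  also have "\<dots> = - (\<Sum>i\<in>I. \<Sum>j\<in>I. (ev Z j - ev Y i) * f (ev Y i) * wt Y Z i j)"
    by (subst sum.swap) (rule refl)
  finally show ?thesis by (simp add: algebra_simps flip: sum_negf)
qed

lemma trf_sq_diff_left:
  assumes "sym_on I Y" "sym_on I Z" 
  shows "trf (sq (\<lambda>a b. Y a b - Z a b)) f Y = (\<Sum>i\<in>I. \<Sum>j\<in>I. (ev Y i - ev Z j)\<^sup>2 * f (ev Y i) * wt Y Z i j)"
proof -
  have "sq (\<lambda>a b. Y a b - Z a b) = sq (\<lambda>a b. Z a b - Y a b)"
    by (intro ext) (simp add: sq_def algebra_simps)
  then have "trf (sq (\<lambda>a b. Y a b - Z a b)) f Y = (\<Sum>j\<in>I. \<Sum>i\<in>I. (ev Z j - ev Y i)\<^sup>2 * f (ev Y i) * wt Y Z i j)"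
    by (simp add: trf_sq_diff_right[OF assms(2,1)] wt_commute[of Y Z])
  then show ?thesis by (subst sum.swap) (simp add: power2_commute)
qed

lemma trf_sum:
  "trf (\<lambda>a b. \<Sum>j\<in>S. c j * B j a b) f Y = (\<Sum>j\<in>S. c j * trf (B j) f Y)"
proof -
  have "qform (\<lambda>a b. \<Sum>j\<in>S. c j * B j a b) v = (\<Sum>j\<in>S. c j * qform (B j) v)" for v
  proof -
    have "qform (\<lambda>a b. \<Sum>j\<in>S. c j * B j a b) v = (\<Sum>a\<in>I. \<Sum>b\<in>I. \<Sum>j\<in>S. c j * (B j a b * v a * v b))"
      by (simp add: qform_def sum_distrib_left sum_distrib_right mult_ac)
    also have "\<dots> = (\<Sum>a\<in>I. \<Sum>j\<in>S. \<Sum>b\<in>I. c j * (B j a b * v a * v b))"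
      by (intro sum.cong refl sum.swap)
    also have "\<dots> = (\<Sum>j\<in>S. \<Sum>a\<in>I. \<Sum>b\<in>I. c j * (B j a b * v a * v b))"
      by (rule sum.swap)
    finally show ?thesis by (simp add: qform_def sum_distrib_left)
  qed
  then have "trf (\<lambda>a b. \<Sum>j\<in>S. c j * B j a b) f Y = (\<Sum>i\<in>I. \<Sum>j\<in>S. c j * (f (ev Y i) * qform (B j) (eu Y i)))"
    by (simp add: trf_def sum_distrib_left mult_ac)
  then show ?thesis by (subst (asm) sum.swap) (simp add: trf_def sum_distrib_left)
qed

lemma qform_ev:
  assumes "sym_on I Y" "j \<in> I" shows "qform Y (eu Y j) = ev Y j"
proof -
  have "qform Y (eu Y j) = (\<Sum>i\<in>I. if i = j then ev Y i else 0)"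
    unfolding qform_eigen[OF eigenbasis_ev[OF assms(1)]]
    using eigenbasis_ev[OF assms(1)] assms(2) by (intro sum.cong refl) (auto simp: eigenbasis_def ip_def)
  then show ?thesis using finI assms(2) by simp
qed

lemma trf_self:
  assumes "sym_on I Y" shows "trf Y f Y = tr1 (\<lambda>x. x * f x) Y"
  by (simp add: trf_def tr1_def qform_ev[OF assms] mult.commute)

lemma psd_ev_nonneg: "psd B \<Longrightarrow> j \<in> I \<Longrightarrow> 0 \<le> ev B j"
  by (metis psd_def qform_ev)

lemma trf_nonneg:
  assumes "psd B" "\<And>x. f x \<ge> 0" shows "trf B f Y \<ge> 0"
  unfolding trf_def using assms by (intro sum_nonneg mult_nonneg_nonneg) (auto simp: psd_def)

end

section \<open>Scalar power inequalities\<close>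

lemma powr_young:
  fixes a b q :: real
  assumes "a \<ge> 0" "b \<ge> 0" "q \<ge> 1"
  shows "a * b powr (q - 1) \<le> a powr q / q + (1 - 1 / q) * b powr q"
proof (cases "q = 1")
  case True
  then show ?thesis using assms by simp
next
  case False
  with assms have q: "q > 1" by simp
  have "a * b powr (q - 1) \<le> a powr q / q + (b powr (q - 1)) powr (q / (q - 1)) / (q / (q - 1))"
    using assms q by (intro Youngs_inequality) (auto simp: field_simps)
  also have "(b powr (q - 1)) powr (q / (q - 1)) / (q / (q - 1)) = (1 - 1 / q) * b powr q"
  proof -
    have e: "(q - 1) * (q / (q - 1)) = q" using q by simp
    have "(b powr (q - 1)) powr (q / (q - 1)) = b powr q" by (simp only: powr_powr e)
    then show ?thesis using q by (simp add: field_simps)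
  qed
  finally show ?thesis .
qed

text \<open>At \<open>x = 0\<close> both sides vanish for every \<open>s\<close>, including
  \<open>s = 0\<close>, since \<open>0 powr s = 0\<close>.\<close>

lemma mult_powr_minus_one: "x \<ge> 0 \<Longrightarrow> x * x powr (s - 1) = x powr (s::real)" for x :: real
  by (cases "x = 0") (simp_all add: powr_diff)

text \<open>Convexity of the power \<open>s\<close>, obtained from Young's inequality for
  \<open>b * a powr (s - 1)\<close> instead of a derivative; the boundary value 0 then needs no
  separate case.\<close>

lemma powr_tangent:
  fixes a b s :: real
  assumes "a \<ge> 0" "b \<ge> 0" "s \<ge> 1"
  shows "a powr s - b powr s \<le> s * (a - b) * a powr (s - 1)"
proof -
  have "s * (b * a powr (s - 1)) \<le> s * (b powr s / s + (1 - 1 / s) * a powr s)"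
    using powr_young[OF assms(2,1,3)] assms by (intro mult_left_mono) auto
  also have "\<dots> = b powr s + (s - 1) * a powr s" using assms by (simp add: field_simps)
  finally have "s * (b * a powr (s - 1)) \<le> b powr s + (s - 1) * a powr s" .
  moreover have "s * (a - b) * a powr (s - 1) = s * a powr s - s * (b * a powr (s - 1))"
    by (subst mult_powr_minus_one[OF assms(1), symmetric]) (simp add: algebra_simps)
  moreover have "(s - 1) * a powr s = s * a powr s - a powr s" by (simp add: left_diff_distrib)
  ultimately show ?thesis by linarith
qed

text \<open>\<open>x * h x\<close> is the odd power sgn(x) |x|^(2q-1); the square inside
  \<open>h\<close> admits negative arguments. For equal signs the bound is the tangent inequality at
  the argument of larger modulus. For opposite signs |a| and |b| are at most |a - b|, and the
  constant 1 suffices.\<close>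

lemma odd_power_increment:
  fixes a b q :: real
  assumes q: "q \<ge> 1"
  defines "h \<equiv> \<lambda>x::real. (x\<^sup>2) powr (q - 1)"
  shows "(a - b) * (a * h a - b * h b) \<le> (2 * q - 1) * (a - b)\<^sup>2 * (h a + h b)"
proof -
  have hnn: "h x \<ge> 0" for x by (simp add: h_def)
  have hp: "h x = x powr (2 * q - 2)" if "x \<ge> 0" for x
  proof (cases "x = 0")
    case False
    with that have "x\<^sup>2 = x powr 2" by simp
    then show ?thesis by (simp add: h_def powr_powr algebra_simps)
  qed (simp add: h_def)
  have nonneg: "(a - b) * (a * h a - b * h b) \<le> (2 * q - 1) * (a - b)\<^sup>2 * (h a + h b)"
    if "0 \<le> b" "b \<le> a" for a b
  proof -
    have g: "x * h x = x powr (2 * q - 1)" if "x \<ge> 0" for x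
      using mult_powr_minus_one[OF that, of "2 * q - 1"] hp[OF that] by (simp add: algebra_simps)
    have "a powr (2 * q - 1) - b powr (2 * q - 1) \<le> (2 * q - 1) * (a - b) * h a"
      using powr_tangent[of a b "2 * q - 1"] that q hp[of a] by (simp add: algebra_simps)
    then have "(a - b) * (a * h a - b * h b) \<le> (a - b) * ((2 * q - 1) * (a - b) * h a)"
      using that g[of a] g[of b] by (intro mult_left_mono) auto
    also have "\<dots> = (2 * q - 1) * (a - b)\<^sup>2 * h a" by (simp add: power2_eq_square)
    also have "\<dots> \<le> (2 * q - 1) * (a - b)\<^sup>2 * (h a + h b)"
      using hnn q by (intro mult_left_mono) auto
    finally show ?thesis .
  qed
  have opp: "(a - b) * (a * h a - b * h b) \<le> (2 * q - 1) * (a - b)\<^sup>2 * (h a + h b)"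
    if "b \<le> 0" "0 \<le> a" for a b
  proof -
    have "a * h a \<le> (a - b) * h a"
      using that hnn by (intro mult_right_mono) auto
    moreover have "(- b) * h b \<le> (a - b) * h b"
      by (rule mult_right_mono) (use that hnn in auto)
    ultimately have "a * h a - b * h b \<le> (a - b) * (h a + h b)" by (simp add: algebra_simps)
    then have "(a - b) * (a * h a - b * h b) \<le> (a - b) * ((a - b) * (h a + h b))"
      using that by (intro mult_left_mono) auto
    also have "\<dots> = 1 * ((a - b)\<^sup>2 * (h a + h b))" by (simp add: power2_eq_square)
    also have "\<dots> \<le> (2 * q - 1) * ((a - b)\<^sup>2 * (h a + h b))"
      using hnn q by (intro mult_right_mono) auto
    finally show ?thesis by (simp add: mult.assoc)
  qed
  have even: "h (- x) = h x" for x by (simp add: h_def)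
  consider "0 \<le> b \<and> b \<le> a" | "0 \<le> a \<and> a \<le> b" | "b \<le> 0 \<and> 0 \<le> a" | "a \<le> 0 \<and> 0 \<le> b"
    | "a \<le> 0 \<and> b \<le> a" | "b \<le> 0 \<and> a \<le> b" by linarith
  then show ?thesis
  proof cases
    case 2 then show ?thesis using nonneg[of a b] by (simp add: algebra_simps power2_eq_square)
  next
    case 4 then show ?thesis using opp[of a b] by (simp add: algebra_simps power2_eq_square)
  next
    case 5 then show ?thesis using nonneg[of "-a" "-b"] by (simp add: even algebra_simps power2_eq_square)
  next
    case 6 then show ?thesis using nonneg[of "-b" "-a"] by (simp add: even algebra_simps power2_eq_square)
  qed (use nonneg opp in auto)
qed

text \<open>The parameter \<open>s\<close> separates \<open>y\<close> near \<open>z\<close> from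
  \<open>y\<close> well above it. Up to \<open>(1 + s) * z\<close> the tangent costs
  \<open>r\<close> and moving its base point from \<open>y\<close> to \<open>z\<close> costs
  \<open>exp (s * r)\<close>. Beyond, \<open>y\<close> is at most \<open>2 / s * (y - z)\<close>,
  and no factor \<open>r\<close> appears: the coefficient of the \<open>y\<close> term is
  \<open>2 / s\<close>, which later decides the size of the leading constant.\<close>

lemma powr_increment_split:
  fixes y z r s :: real
  assumes yz: "y \<ge> 0" "z \<ge> 0" and r: "r \<ge> 1" and s: "0 < s" "s \<le> 1"
  shows "(y - z) * (y powr r - z powr r)
    \<le> r * exp (s * r) * (y - z)\<^sup>2 * z powr (r - 1) + 2 / s * (y - z)\<^sup>2 * y powr (r - 1)"
proof -
  have e1: "exp (s * r) \<ge> 1" using r s by simp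
  consider "y \<le> z" | "z \<le> y" "y \<le> (1 + s) * z" | "y > (1 + s) * z" by linarith
  then show ?thesis
  proof cases
    case 1
    have "(z - y) * (z powr r - y powr r) \<le> (z - y) * (r * (z - y) * z powr (r - 1))"
      using 1 powr_tangent[OF yz(2,1) r] by (intro mult_left_mono) auto
    also have "\<dots> = r * 1 * (y - z)\<^sup>2 * z powr (r - 1)" by (simp add: power2_eq_square algebra_simps)
    also have "\<dots> \<le> r * exp (s * r) * (y - z)\<^sup>2 * z powr (r - 1)"
      using e1 r by (intro mult_right_mono mult_left_mono) auto
    finally have "(y - z) * (y powr r - z powr r) \<le> r * exp (s * r) * (y - z)\<^sup>2 * z powr (r - 1)"
      by (simp add: algebra_simps)
    moreover have "0 \<le> 2 / s * (y - z)\<^sup>2 * y powr (r - 1)" using s by simp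
    ultimately show ?thesis by linarith
  next
    case 2
    have "y powr (r - 1) \<le> ((1 + s) * z) powr (r - 1)"
      using 2 yz r by (intro powr_mono2) auto
    also have "\<dots> = (1 + s) powr (r - 1) * z powr (r - 1)" using s yz by (simp add: powr_mult)
    also have "\<dots> \<le> exp (s * r) * z powr (r - 1)"
    proof (intro mult_right_mono)
      have "(1 + s) powr (r - 1) \<le> exp s powr (r - 1)"
        using s r by (intro powr_mono2) auto
      also have "\<dots> = exp (s * (r - 1))" by (simp add: powr_def mult.commute)
      also have "\<dots> \<le> exp (s * r)" using s by simp
      finally show "(1 + s) powr (r - 1) \<le> exp (s * r)" .
    qed simp
    finally have pw: "y powr (r - 1) \<le> exp (s * r) * z powr (r - 1)" .
    have "(y - z) * (y powr r - z powr r) \<le> (y - z) * (r * (y - z) * y powr (r - 1))"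
      using 2 powr_tangent[OF yz r] by (intro mult_left_mono) auto
    also have "\<dots> \<le> (y - z) * (r * (y - z) * (exp (s * r) * z powr (r - 1)))"
      using 2 r by (intro mult_left_mono pw) auto
    also have "\<dots> = r * exp (s * r) * (y - z)\<^sup>2 * z powr (r - 1)"
      by (simp add: power2_eq_square)
    finally have "(y - z) * (y powr r - z powr r) \<le> r * exp (s * r) * (y - z)\<^sup>2 * z powr (r - 1)" .
    moreover have "0 \<le> 2 / s * (y - z)\<^sup>2 * y powr (r - 1)" using s by simp
    ultimately show ?thesis by linarith
  next
    case 3
    have sz: "0 \<le> s * z" using s yz by simp
    then have yz': "z \<le> y" using 3 by (simp add: algebra_simps)
    \<comment> \<open>The factor \<open>2 - s\<close> works because (2 - s)(1 + s) = 2 + s - s^2 is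
      at least 2 for \<open>s\<close> in (0, 1]; this rearranges to
      \<open>s * y \<le> 2 * (y - z)\<close>.\<close>
    have "(2 - s) * ((1 + s) * z) \<le> (2 - s) * y"
      using 3 s by (intro mult_left_mono) auto
    moreover have "(2 - s) * ((1 + s) * z) = 2 * z + (s - s * s) * z" by (simp add: algebra_simps)
    moreover have "0 \<le> (s - s * s) * z"
      using s yz mult_left_mono[of s 1 s] by (intro mult_nonneg_nonneg) auto
    ultimately have "s * y \<le> 2 * (y - z)" by (simp add: algebra_simps)
    then have yle: "y \<le> 2 / s * (y - z)" using s by (simp add: field_simps)
    have "(y - z) * (y powr r - z powr r) \<le> (y - z) * (y * y powr (r - 1))"
      using yz' mult_powr_minus_one[OF yz(1), of r] by (intro mult_left_mono) auto
    also have "\<dots> \<le> (y - z) * (2 / s * (y - z) * y powr (r - 1))"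
      using yz' yle by (intro mult_left_mono mult_right_mono) auto
    also have "\<dots> = 2 / s * (y - z)\<^sup>2 * y powr (r - 1)" by (simp add: power2_eq_square)
    finally have "(y - z) * (y powr r - z powr r) \<le> 2 / s * (y - z)\<^sup>2 * y powr (r - 1)" .
    moreover have "0 \<le> r * exp (s * r) * (y - z)\<^sup>2 * z powr (r - 1)" using r by simp
    ultimately show ?thesis by linarith
  qed
qed

text \<open>Either \<open>b\<close> is at most \<open>\<sigma> * y\<close>, which gives the first
  term, or \<open>y\<close> is below \<open>b / \<sigma>\<close>, which gives the second.\<close>

lemma powr_split_threshold:
  fixes b y r \<sigma> :: real
  assumes "b \<ge> 0" "y \<ge> 0" "r \<ge> 1" "\<sigma> > 0"
  shows "b * y powr (r - 1) \<le> \<sigma> * y powr r + \<sigma> powr (1 - r) * b powr r"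
proof (cases "b \<le> \<sigma> * y")
  case True
  then have "b * y powr (r - 1) \<le> \<sigma> * y * y powr (r - 1)" by (intro mult_right_mono) auto
  also have "\<dots> = \<sigma> * y powr r" using mult_powr_minus_one[OF assms(2), of r] by (simp add: mult.assoc)
  finally show ?thesis by (smt (verit) mult_nonneg_nonneg powr_ge_zero)
next
  case False
  then have "y \<le> b / \<sigma>" using assms by (simp add: field_simps)
  then have "y powr (r - 1) \<le> (b / \<sigma>) powr (r - 1)" using assms by (intro powr_mono2) auto
  then have "b * y powr (r - 1) \<le> b * (b / \<sigma>) powr (r - 1)" using assms by (intro mult_left_mono) auto
  also have "(b / \<sigma>) powr (r - 1) = b powr (r - 1) * \<sigma> powr (1 - r)"
    using assms by (simp add: powr_divide powr_minus_divide[of \<sigma> "r - 1", symmetric])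
       (simp add: divide_inverse flip: powr_minus)
  also have "b * (b powr (r - 1) * \<sigma> powr (1 - r)) = \<sigma> powr (1 - r) * b powr r"
    using mult_powr_minus_one[OF assms(1), of r] by (simp add: algebra_simps)
  finally show ?thesis using assms by (smt (verit) mult_nonneg_nonneg powr_ge_zero)
qed

text \<open>After expansion this compares \<open>z * y powr (r - 1)\<close> with
  \<open>z powr r\<close>, that is, it is antitonicity of the power \<open>r - 1\<close>. The error
  is weighted at \<open>y\<close> alone; in the application \<open>y\<close> belongs to the larger
  matrix, which dominates the increment.\<close>

lemma powr_increment_concave:
  fixes y z r :: real
  assumes "y > 0" "z \<ge> 0" "0 \<le> r" "r \<le> 1"
  shows "(y - z) * (y powr r - z powr r) \<le> (y - z)\<^sup>2 * y powr (r - 1)"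
proof -
  have "(y - z) * (z * y powr (r - 1)) \<le> (y - z) * z powr r"
  proof (cases "z = 0")
    case False
    with assms have z: "z > 0" by simp
    have zr: "z powr r = z * z powr (r - 1)" using mult_powr_minus_one[of z r] z by simp
    show ?thesis
    proof (cases "z \<le> y")
      case True
      then have "y powr (r - 1) \<le> z powr (r - 1)" using z assms by (intro powr_mono2') auto
      then show ?thesis unfolding zr using True z by (intro mult_left_mono) auto
    next
      case False
      then have "z powr (r - 1) \<le> y powr (r - 1)" using z assms by (intro powr_mono2') auto
      then show ?thesis unfolding zr using False z by (intro mult_left_mono_neg mult_left_mono) auto
    qed
  qed simp
  moreover have "y powr r = y * y powr (r - 1)" using mult_powr_minus_one[of y r] assms by simp
  ultimately show ?thesis by (simp add: algebra_simps power2_eq_square)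
qed

text \<open>Weighted arithmetic-geometric mean of 1 and \<open>b / y\<close>: the negative power is
  reduced to the quotient \<open>b / y\<close>, which can be controlled when one matrix dominates
  the other. At \<open>y = 0\<close> the quotient and the power are both 0 by convention.\<close>

lemma square_mult_powr_le:
  fixes b y r :: real
  assumes "b \<ge> 0" "y \<ge> 0" "0 \<le> r" "r \<le> 1"
  shows "b\<^sup>2 * y powr (r - 1) \<le> r * b powr (1 + r) + (1 - r) * (b powr (1 + r) * (b / y))"
proof (cases "b = 0 \<or> y = 0")
  case True
  then show ?thesis using assms by auto
next
  case False
  with assms have pos: "b > 0" "y > 0" by auto
  have "1 powr r * (b / y) powr (1 - r) \<le> r * 1 + (1 - r) * (b / y)"
    using assms pos by (intro Youngs_inequality_0) auto
  then have "b powr (1 + r) * (b / y) powr (1 - r) \<le> b powr (1 + r) * (r + (1 - r) * (b / y))"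
    by (intro mult_left_mono) auto
  moreover have "b powr (1 + r) * (b / y) powr (1 - r) = b\<^sup>2 * y powr (r - 1)"
  proof -
    have "b powr (1 + r) * (b / y) powr (1 - r) = b powr (1 + r) * b powr (1 - r) / y powr (1 - r)"
      using pos by (simp add: powr_divide)
    also have "b powr (1 + r) * b powr (1 - r) = b\<^sup>2"
      using pos by (simp flip: powr_add)
    also have "b\<^sup>2 / y powr (1 - r) = b\<^sup>2 * y powr (r - 1)"
      using powr_minus_divide[of y "1 - r"] by simp
    finally show ?thesis .
  qed
  ultimately show ?thesis by (simp add: algebra_simps)
qed

section \<open>Trace inequalities for powers\<close>

context finite_index
begin

text \<open>Linear and monotone in the symbol \<open>F\<close>, so a trace inequality becomes a
  pointwise inequality of symbols, on nonnegative arguments when both matrices are positive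
  semidefinite.\<close>

definition dsum :: "('i \<Rightarrow> 'i \<Rightarrow> real) \<Rightarrow> ('i \<Rightarrow> 'i \<Rightarrow> real) \<Rightarrow> (real \<Rightarrow> real \<Rightarrow> real) \<Rightarrow> real" where
  "dsum Y Z F = (\<Sum>i\<in>I. \<Sum>j\<in>I. F (ev Y i) (ev Z j) * wt Y Z i j)"

lemma dsum_mono: "(\<And>y z. F y z \<le> G y z) \<Longrightarrow> dsum Y Z F \<le> dsum Y Z G"
  unfolding dsum_def by (intro sum_mono mult_right_mono wt_nonneg) auto

lemma dsum_mono_psd:
  assumes "psd Y" "psd Z" "\<And>y z. y \<ge> 0 \<Longrightarrow> z \<ge> 0 \<Longrightarrow> F y z \<le> G y z"
  shows "dsum Y Z F \<le> dsum Y Z G"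
  unfolding dsum_def using assms by (intro sum_mono mult_right_mono wt_nonneg) (auto simp: psd_ev_nonneg)

lemma dsum_add: "dsum Y Z (\<lambda>y z. F y z + G y z) = dsum Y Z F + dsum Y Z G"
  by (simp add: dsum_def distrib_right sum.distrib)

lemma dsum_diff: "dsum Y Z (\<lambda>y z. F y z - G y z) = dsum Y Z F - dsum Y Z G"
  by (simp add: dsum_def left_diff_distrib sum_subtractf)

lemma dsum_cmult: "dsum Y Z (\<lambda>y z. c * F y z) = c * dsum Y Z F"
  by (simp add: dsum_def sum_distrib_left mult_ac)

lemma psd_sym: "psd Y \<Longrightarrow> sym_on I Y" by (simp add: psd_def)

lemma psd_qform: "psd Y \<Longrightarrow> 0 \<le> qform Y v" by (simp add: psd_def)

lemma dsum_left: "sym_on I Y \<Longrightarrow> sym_on I Z \<Longrightarrow> dsum Y Z (\<lambda>y z. f y) = tr1 f Y"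
  unfolding dsum_def by (rule tr1_wt_left[symmetric])

lemma dsum_right: "sym_on I Y \<Longrightarrow> sym_on I Z \<Longrightarrow> dsum Y Z (\<lambda>y z. f z) = tr1 f Z"
  unfolding dsum_def by (rule tr1_wt_right[symmetric])

lemma trf_dsum: "sym_on I B \<Longrightarrow> trf B f Y = dsum B Y (\<lambda>b y. b * f y)"
  by (simp add: dsum_def trf_wt)

lemma trf_sq_dsum: "sym_on I B \<Longrightarrow> trf (sq B) f Y = dsum B Y (\<lambda>b y. b\<^sup>2 * f y)"
  by (simp add: dsum_def trf_sq_wt)

lemma trf_diff_dsum:
  assumes "sym_on I Y" "sym_on I Z"
  shows "trf (\<lambda>a b. Y a b - Z a b) f Y = dsum Y Z (\<lambda>y z. (y - z) * f y)"
    "trf (\<lambda>a b. Y a b - Z a b) f Z = dsum Y Z (\<lambda>y z. (y - z) * f z)"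
    "trf (sq (\<lambda>a b. Y a b - Z a b)) f Y = dsum Y Z (\<lambda>y z. (y - z)\<^sup>2 * f y)"
    "trf (sq (\<lambda>a b. Y a b - Z a b)) f Z = dsum Y Z (\<lambda>y z. (y - z)\<^sup>2 * f z)"
  by (simp_all add: dsum_def trf_diff_left[OF assms] trf_diff_right[OF assms]
      trf_sq_diff_left[OF assms] trf_sq_diff_right[OF assms])

lemma qform_add: "qform (\<lambda>a b. Z a b + B a b) v = qform Z v + qform B v"
  by (simp add: qform_def distrib_right sum.distrib)

lemma psd_add: "psd Z \<Longrightarrow> psd B \<Longrightarrow> psd (\<lambda>a b. Z a b + B a b)"
  by (simp add: psd_def qform_add sym_on_def)

lemma psd_zero: "psd (\<lambda>a b. 0)"
  by (simp add: psd_def qform_def sym_on_def)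

lemma psd_sum: 
  assumes "\<And>j. j \<in> S \<Longrightarrow> psd (B j)" shows "psd (\<lambda>a b. \<Sum>j\<in>S. B j a b)"
proof (cases "finite S")
  case True
  then show ?thesis using assms
    by (induction S) (simp_all add: psd_zero psd_add)
qed (simp add: psd_zero)

text \<open>\<open>square_mult_powr_le\<close> reduces the negative power of \<open>Y\<close> to its
  inverse, and there domination of \<open>B\<close> by \<open>Y\<close> says that B^(1/2) Y^(-1)
  B^(1/2) is at most the identity.\<close>

lemma trf_sq_le_dominated:
  assumes B: "psd B" and Y: "sym_on I Y" and le: "\<And>v. qform B v \<le> qform Y v" and r: "0 \<le> r" "r \<le> 1"
  shows "trf (sq B) (\<lambda>y. y powr (r - 1)) Y \<le> tr1 (\<lambda>x. x powr (1 + r)) B"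
proof -
  have sB: "sym_on I B" using B by (rule psd_sym)
  have Yp: "psd Y" unfolding psd_def using Y order_trans[OF psd_qform[OF B] le] by simp
  \<comment> \<open>The sum is the \<open>k\<close>-th diagonal entry of Y^(-1) in the eigenbasis of
    \<open>B\<close>, with 1/0 = 0. Testing \<open>le\<close> at \<open>v\<close>, the image of
    \<open>eu B k\<close> under Y^(-1), gives \<open>ev B k * s\<^sup>2 \<le> s\<close>.\<close>
  have inv: "ev B k * (\<Sum>j\<in>I. wt B Y k j / ev Y j) \<le> 1" if k: "k \<in> I" for k
  proof -
    define c where "c = (\<lambda>j. ip (eu B k) (eu Y j))"
    define s where "s = (\<Sum>j\<in>I. (c j)\<^sup>2 / ev Y j)"
    define v where "v = (\<lambda>a. \<Sum>j\<in>I. (c j / ev Y j) * eu Y j a)"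
    have ipv: "ip x v = (\<Sum>j\<in>I. (c j / ev Y j) * ip x (eu Y j))" for x
    proof -
      have "ip x v = (\<Sum>a\<in>I. \<Sum>j\<in>I. (c j / ev Y j) * (x a * eu Y j a))"
        by (simp add: ip_def v_def sum_distrib_left mult_ac)
      then show ?thesis by (subst (asm) sum.swap) (simp add: ip_def sum_distrib_left)
    qed
    have s1: "ip (eu B k) v = s"
      unfolding ipv s_def by (intro sum.cong refl) (simp add: c_def power2_eq_square)
    have ipY: "ip (eu Y m) v = c m / ev Y m" if m: "m \<in> I" for m
    proof -
      have "ip (eu Y m) v = (\<Sum>j\<in>I. if m = j then c j / ev Y j else 0)"
        unfolding ipv using eigenbasis_ev[OF Y] m
        by (intro sum.cong refl) (auto simp: eigenbasis_def ip_def)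
      then show ?thesis using finI m by simp
    qed
    have "qform Y v = s"
      unfolding qform_eigen[OF eigenbasis_ev[OF Y]] s_def
      by (intro sum.cong refl) (simp add: ipY power2_eq_square)
    moreover have "ev B k * s\<^sup>2 \<le> qform B v"
      unfolding qform_eigen[OF eigenbasis_ev[OF sB]] s1[symmetric]
      using k finI psd_ev_nonneg[OF B] by (intro member_le_sum) auto
    ultimately have "ev B k * s * s \<le> 1 * s"
      using le[of v] by (simp add: power2_eq_square)
    moreover have "s \<ge> 0" unfolding s_def using psd_ev_nonneg[OF Yp] by (simp add: sum_nonneg)
    ultimately have "ev B k * s \<le> 1"
      by (cases "s = 0") (auto dest: mult_right_le_imp_le)
    then show ?thesis by (simp add: s_def c_def wt_def)
  qed
  have "trf (sq B) (\<lambda>y. y powr (r - 1)) Y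
      \<le> dsum B Y (\<lambda>b y. r * b powr (1 + r) + (1 - r) * (b powr (1 + r) * (b / y)))"
    unfolding trf_sq_dsum[OF sB] using r by (intro dsum_mono_psd B Yp square_mult_powr_le) auto
  also have "\<dots> = r * tr1 (\<lambda>x. x powr (1 + r)) B + (1 - r) * dsum B Y (\<lambda>b y. b powr (1 + r) * (b / y))"
    unfolding dsum_add dsum_cmult dsum_left[OF sB Y] by (rule refl)
  also have "\<dots> \<le> r * tr1 (\<lambda>x. x powr (1 + r)) B + (1 - r) * tr1 (\<lambda>x. x powr (1 + r)) B"
  proof (intro add_left_mono mult_left_mono)
    have "dsum B Y (\<lambda>b y. b powr (1 + r) * (b / y))
        = (\<Sum>i\<in>I. ev B i powr (1 + r) * (ev B i * (\<Sum>j\<in>I. wt B Y i j / ev Y j)))"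
      by (simp add: dsum_def sum_distrib_left mult_ac)
    also have "\<dots> \<le> (\<Sum>i\<in>I. ev B i powr (1 + r) * 1)"
      by (intro sum_mono mult_left_mono inv) auto
    finally show "dsum B Y (\<lambda>b y. b powr (1 + r) * (b / y)) \<le> tr1 (\<lambda>x. x powr (1 + r)) B"
      by (simp add: tr1_def)
  qed (use r in simp)
  finally show ?thesis by (simp add: left_diff_distrib)
qed

text \<open>The form of \<open>Z\<close> vanishes at null vectors of \<open>Y\<close>, and as a sum
  of nonnegative terms it vanishes termwise. This settles the pairs with \<open>y = 0\<close>, which
  \<open>powr_increment_concave\<close> excludes.\<close>

lemma ev_zero_weight:
  assumes "psd Z" "sym_on I Y" "\<And>v. qform Z v \<le> qform Y v" "i \<in> I" "j \<in> I" "ev Y i = 0"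
  shows "ev Z j * wt Y Z i j = 0"
proof -
  have "(\<Sum>j\<in>I. ev Z j * wt Z Y j i) \<le> 0"
    using assms(3)[of "eu Y i"] qform_ev[OF assms(2,4)] assms(6)
    unfolding qform_eigen[OF eigenbasis_ev[OF psd_sym[OF assms(1)]]] wt_def by simp
  moreover have nn: "ev Z j * wt Z Y j i \<ge> 0" if "j \<in> I" for j
    using psd_ev_nonneg[OF assms(1) that] by (simp add: wt_nonneg)
  ultimately have "(\<Sum>j\<in>I. ev Z j * wt Z Y j i) = 0"
    by (intro antisym sum_nonneg)
  then have "\<forall>j\<in>I. ev Z j * wt Z Y j i = 0"
    using nn by (subst (asm) sum_nonneg_eq_0_iff[OF finI]) simp_all
  with assms(5) have "ev Z j * wt Z Y j i = 0" by blast
  then show ?thesis by (simp add: wt_commute)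
qed

text \<open>The error left by the concave scalar bound is tr B^2 Y^(r-1), whose negative power is
  harmless because \<open>B\<close> is dominated by \<open>Y = Z + B\<close>. With
  \<open>q = 1 + r\<close> this covers \<open>q\<close> between 1 and 2.\<close>

lemma trf_add_powr_concave:
  assumes B: "psd B" and Z: "psd Z" and r: "0 \<le> r" "r \<le> 1"
  defines "Y \<equiv> \<lambda>a b. Z a b + B a b"
  shows "trf B (\<lambda>y. y powr r) Y \<le> trf B (\<lambda>z. z powr r) Z + tr1 (\<lambda>x. x powr (1 + r)) B"
proof -
  have Y: "psd Y" unfolding Y_def by (rule psd_add[OF Z B])
  note sY = psd_sym[OF Y] and sZ = psd_sym[OF Z]
  have D: "B = (\<lambda>a b. Y a b - Z a b)" by (simp add: Y_def)
  have leZ: "qform Z v \<le> qform Y v" and leB: "qform B v \<le> qform Y v" for v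
    unfolding Y_def qform_add using psd_qform[OF B] psd_qform[OF Z] by auto
  have "trf B (\<lambda>y. y powr r) Y - trf B (\<lambda>z. z powr r) Z
      = dsum Y Z (\<lambda>y z. (y - z) * (y powr r - z powr r))"
    unfolding D trf_diff_dsum[OF sY sZ] by (simp add: right_diff_distrib dsum_diff)
  also have "\<dots> \<le> dsum Y Z (\<lambda>y z. (y - z)\<^sup>2 * y powr (r - 1))"
    unfolding dsum_def
  proof (intro sum_mono)
    fix i j assume ij: "i \<in> I" "j \<in> I"
    show "(ev Y i - ev Z j) * (ev Y i powr r - ev Z j powr r) * wt Y Z i j
       \<le> (ev Y i - ev Z j)\<^sup>2 * ev Y i powr (r - 1) * wt Y Z i j"
    proof (cases "ev Y i = 0")
      \<comment> \<open>The right-hand side is 0 here, since \<open>0 powr (r - 1) = 0\<close>.\<close>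
      case True
      with ev_zero_weight[OF Z sY leZ ij] have "ev Z j = 0 \<or> wt Y Z i j = 0" by simp
      then show ?thesis using True by auto
    next
      case False
      then show ?thesis using psd_ev_nonneg[OF Y ij(1)] psd_ev_nonneg[OF Z ij(2)] r
        by (intro mult_right_mono wt_nonneg powr_increment_concave) auto
    qed
  qed
  also have "\<dots> = trf (sq B) (\<lambda>y. y powr (r - 1)) Y"
    unfolding D trf_diff_dsum[OF sY sZ] by simp
  also have "\<dots> \<le> tr1 (\<lambda>x. x powr (1 + r)) B"
    by (rule trf_sq_le_dominated[OF B sY leB r])
  finally show ?thesis by simp
qed

lemma trf_sq_powr_split:
  assumes "psd B" "psd Y" "r \<ge> 1" "\<sigma> > 0"
  shows "trf (sq B) (\<lambda>y. y powr (r - 1)) Y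
    \<le> \<sigma> * trf B (\<lambda>y. y powr r) Y + \<sigma> powr (1 - r) * tr1 (\<lambda>x. x powr (1 + r)) B"
proof -
  note sB = psd_sym[OF assms(1)] and sY = psd_sym[OF assms(2)]
  have "trf (sq B) (\<lambda>y. y powr (r - 1)) Y
     \<le> dsum B Y (\<lambda>b y. \<sigma> * (b * y powr r) + \<sigma> powr (1 - r) * b powr (1 + r))"
    unfolding trf_sq_dsum[OF sB]
  proof (intro dsum_mono_psd assms)
    fix b y :: real assume "b \<ge> 0" "y \<ge> 0"
    then have "b * (b * y powr (r - 1)) \<le> b * (\<sigma> * y powr r + \<sigma> powr (1 - r) * b powr r)"
      using assms by (intro mult_left_mono powr_split_threshold) auto
    moreover have "b * b powr r = b powr (1 + r)"
      using mult_powr_minus_one[OF \<open>b \<ge> 0\<close>, of "1 + r"] by simp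
    ultimately show "b\<^sup>2 * y powr (r - 1) \<le> \<sigma> * (b * y powr r) + \<sigma> powr (1 - r) * b powr (1 + r)"
    proof -
      assume "b * b powr r = b powr (1 + r)"
      then have "b * (\<sigma> * y powr r + \<sigma> powr (1 - r) * b powr r) = \<sigma> * (b * y powr r) + \<sigma> powr (1 - r) * b powr (1 + r)"
        by (simp add: distrib_left mult.left_commute)
      moreover assume "b * (b * y powr (r - 1)) \<le> b * (\<sigma> * y powr r + \<sigma> powr (1 - r) * b powr r)"
      ultimately show ?thesis by (simp add: power2_eq_square mult.assoc)
    qed
  qed
  also have "\<dots> = \<sigma> * trf B (\<lambda>y. y powr r) Y + \<sigma> powr (1 - r) * tr1 (\<lambda>x. x powr (1 + r)) B"
    unfolding dsum_add dsum_cmult dsum_left[OF sB sY] trf_dsum[OF sB] by (rule refl)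
  finally show ?thesis .
qed

text \<open>Of the two error terms of \<open>powr_increment_split\<close>, the one at
  \<open>Y\<close> contains the unknown itself. Splitting it at \<sigma> = s/4 against its
  coefficient 2/s leaves exactly half of tr B Y^r, which is absorbed on the left at the price of
  doubling the rest.\<close>

lemma trf_add_powr_convex:
  assumes B: "psd B" and Z: "psd Z" and r: "r \<ge> 1" and s: "0 < s" "s \<le> 1"
  defines "Y \<equiv> \<lambda>a b. Z a b + B a b"
  shows "trf B (\<lambda>y. y powr r) Y \<le> (2 + r * exp (s * r) * s / 2) * trf B (\<lambda>z. z powr r) Z
    + (4 / s) powr (r - 1) * (4 / s + 2 * r * exp (s * r)) * tr1 (\<lambda>x. x powr (1 + r)) B"
proof -
  have Y: "psd Y" unfolding Y_def by (rule psd_add[OF Z B])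
  note sY = psd_sym[OF Y] and sZ = psd_sym[OF Z]
  have D: "B = (\<lambda>a b. Y a b - Z a b)" by (simp add: Y_def)
  define TY where "TY = trf B (\<lambda>y. y powr r) Y"
  define TZ where "TZ = trf B (\<lambda>y. y powr r) Z"
  define \<beta> where "\<beta> = (4 / s) powr (r - 1) * tr1 (\<lambda>x. x powr (1 + r)) B"
  define e where "e = r * exp (s * r)"
  have e: "e \<ge> 0" using r by (simp add: e_def)
  have c: "(s / 4) powr (1 - r) = (4 / s) powr (r - 1)"
    using s by (simp add: powr_divide powr_diff field_simps)
  have split: "trf (sq B) (\<lambda>y. y powr (r - 1)) X \<le> s / 4 * trf B (\<lambda>y. y powr r) X + \<beta>" if "psd X" for X
    using trf_sq_powr_split[OF B that r, of "s / 4"] s by (simp add: \<beta>_def c)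
  have "TY - TZ = dsum Y Z (\<lambda>y z. (y - z) * (y powr r - z powr r))"
    unfolding TY_def TZ_def D trf_diff_dsum[OF sY sZ] by (simp add: right_diff_distrib dsum_diff)
  also have "\<dots> \<le> dsum Y Z (\<lambda>y z. e * ((y - z)\<^sup>2 * z powr (r - 1)) + 2 / s * ((y - z)\<^sup>2 * y powr (r - 1)))"
    using powr_increment_split[OF _ _ r s] by (intro dsum_mono_psd Y Z) (simp add: e_def mult.assoc)
  also have "\<dots> = e * trf (sq B) (\<lambda>y. y powr (r - 1)) Z + 2 / s * trf (sq B) (\<lambda>y. y powr (r - 1)) Y"
    unfolding D trf_diff_dsum[OF sY sZ] dsum_add dsum_cmult by simp
  also have "\<dots> \<le> e * (s / 4 * TZ + \<beta>) + 2 / s * (s / 4 * TY + \<beta>)"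
    unfolding TY_def TZ_def using s e by (intro add_mono mult_left_mono split Y Z) auto
  also have "\<dots> = e * s / 4 * TZ + TY / 2 + (e + 2 / s) * \<beta>" using s by (simp add: field_simps)
  finally have "TY \<le> (2 + e * s / 2) * TZ + (4 / s + 2 * e) * \<beta>" by (simp add: field_simps)
  then show ?thesis unfolding TY_def TZ_def e_def \<beta>_def by (simp add: algebra_simps)
qed

text \<open>Klein's inequality for the power function: the scalar tangent at \<open>z\<close>,
  summed over all pairs of eigenvalues. It is the source of both monotonicity and Jensen's
  inequality for tr Y^q.\<close>

lemma tr1_powr_tangent:
  assumes Y: "psd Y" and Z: "psd Z" and q: "q \<ge> 1"
  shows "tr1 (\<lambda>z. z powr q) Z + q * trf (\<lambda>a b. Y a b - Z a b) (\<lambda>z. z powr (q - 1)) Z \<le> tr1 (\<lambda>y. y powr q) Y"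
proof -
  note sY = psd_sym[OF Y] and sZ = psd_sym[OF Z]
  have "tr1 (\<lambda>z. z powr q) Z + q * trf (\<lambda>a b. Y a b - Z a b) (\<lambda>z. z powr (q - 1)) Z
     = dsum Y Z (\<lambda>y z. z powr q + q * ((y - z) * z powr (q - 1)))"
    unfolding dsum_add dsum_cmult dsum_right[OF sY sZ] trf_diff_dsum[OF sY sZ] by (rule refl)
  also have "\<dots> \<le> dsum Y Z (\<lambda>y z. y powr q)"
  proof (intro dsum_mono_psd Y Z)
    fix y z :: real assume "y \<ge> 0" "z \<ge> 0"
    then show "z powr q + q * ((y - z) * z powr (q - 1)) \<le> y powr q"
      using powr_tangent[of z y q] q by (simp add: algebra_simps)
  qed
  also have "\<dots> = tr1 (\<lambda>y. y powr q) Y" by (rule dsum_left[OF sY sZ])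
  finally show ?thesis .
qed

lemma tr1_powr_mono:
  assumes B: "psd B" and Z: "psd Z" and q: "q \<ge> 1"
  shows "tr1 (\<lambda>z. z powr q) Z \<le> tr1 (\<lambda>y. y powr q) (\<lambda>a b. Z a b + B a b)"
proof -
  have D: "(\<lambda>a b. Z a b + B a b - Z a b) = B" by simp
  have "0 \<le> q * trf B (\<lambda>z. z powr (q - 1)) Z" using trf_nonneg[OF B] q by simp
  then show ?thesis using tr1_powr_tangent[OF psd_add[OF Z B] Z q] unfolding D by linarith
qed

lemma trf_young:
  assumes B: "psd B" and Y: "psd Y" and q: "q \<ge> 1" and c: "c \<ge> 0"
  shows "c * trf B (\<lambda>y. y powr (q - 1)) Y \<le> c powr q * tr1 (\<lambda>x. x powr q) B / q + (1 - 1 / q) * tr1 (\<lambda>y. y powr q) Y"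
proof -
  note sB = psd_sym[OF B] and sY = psd_sym[OF Y]
  have "c * trf B (\<lambda>y. y powr (q - 1)) Y = dsum B Y (\<lambda>b y. c * (b * y powr (q - 1)))"
    unfolding dsum_cmult trf_dsum[OF sB] by (rule refl)
  also have "\<dots> \<le> dsum B Y (\<lambda>b y. c powr q / q * b powr q + (1 - 1 / q) * y powr q)"
  proof (intro dsum_mono_psd B Y)
    fix b y :: real assume "b \<ge> 0" "y \<ge> 0"
    then show "c * (b * y powr (q - 1)) \<le> c powr q / q * b powr q + (1 - 1 / q) * y powr q"
      using powr_young[of "c * b" y q] c q by (simp add: powr_mult mult.assoc)
  qed
  also have "\<dots> = c powr q * tr1 (\<lambda>x. x powr q) B / q + (1 - 1 / q) * tr1 (\<lambda>y. y powr q) Y"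
    unfolding dsum_add dsum_cmult dsum_left[OF sB sY] dsum_right[OF sB sY] by simp
  finally show ?thesis .
qed

end

section \<open>Khinchine inequalities\<close>

lemma sign_vectors_bij:
  "bij_betw (\<lambda>T j. if j \<in> {1..n} then (if j \<in> T then 1 else -1) else (0::real)) (Pow {1..n}) (sign_vectors n)"
proof (rule bij_betw_byWitness[where f' = "\<lambda>\<epsilon>. {j\<in>{1..n}. \<epsilon> j = 1}"])
  show "\<forall>\<epsilon>\<in>sign_vectors n. (\<lambda>j. if j \<in> {1..n} then (if j \<in> {j\<in>{1..n}. \<epsilon> j = 1} then 1 else -1) else 0) = \<epsilon>"
    unfolding sign_vectors_def by (intro ballI ext) force
qed (auto simp: sign_vectors_def)

lemma card_sign_vectors: "card (sign_vectors n) = 2 ^ n"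
  using bij_betw_same_card[OF sign_vectors_bij, of n] by (simp add: card_Pow)

lemma sign_vectors_square: "\<epsilon> \<in> sign_vectors n \<Longrightarrow> j \<in> {1..n} \<Longrightarrow> \<epsilon> j * \<epsilon> j = 1"
  by (force simp: sign_vectors_def)

lemma sum_sign_vectors_flip:
  assumes "j \<in> {1..n}"
  shows "(\<Sum>\<epsilon>\<in>sign_vectors n. f \<epsilon>) = (\<Sum>\<epsilon>\<in>sign_vectors n. f (\<epsilon>(j := - \<epsilon> j)) :: real)"
  using assms
  by (intro sum.reindex_bij_witness[where i = "\<lambda>\<epsilon>. \<epsilon>(j := - \<epsilon> j)" and j = "\<lambda>\<epsilon>. \<epsilon>(j := - \<epsilon> j)"])
     (auto simp: sign_vectors_def)

lemma sum_sign_vectors_mult: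
  assumes "j \<in> {1..n}" "k \<in> {1..n}"
  shows "(\<Sum>\<epsilon>\<in>sign_vectors n. \<epsilon> j * \<epsilon> k) = (if j = k then 2 ^ n else 0)"
proof (cases "j = k")
  case True
  then show ?thesis using assms by (simp add: sign_vectors_square card_sign_vectors)
next
  case False
  have "(\<Sum>\<epsilon>\<in>sign_vectors n. \<epsilon> j * \<epsilon> k) = (\<Sum>\<epsilon>\<in>sign_vectors n. - (\<epsilon> j * \<epsilon> k))"
    using False by (subst sum_sign_vectors_flip[OF assms(1)]) simp
  then show ?thesis using False by (simp add: sum_negf)
qed

context finite_index
begin

lemma trf_cmult: "trf (\<lambda>a b. c * B a b) f Y = c * trf B f Y"
  using trf_sum[of "\<lambda>_. c" "\<lambda>_::unit. B" UNIV f Y] by simp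

lemma sym_on_sum: "(\<And>j. j \<in> S \<Longrightarrow> sym_on I (H j)) \<Longrightarrow> sym_on I (\<lambda>a b. \<Sum>j\<in>S. c j * H j a b)"
  by (auto simp: sym_on_def intro!: sum.cong)

lemma trf_odd_power_increment:
  assumes X: "sym_on I X" "sym_on I X'" and q: "q \<ge> 1"
  defines "h \<equiv> \<lambda>x::real. (x\<^sup>2) powr (q - 1)"
  shows "trf (\<lambda>a b. X a b - X' a b) (\<lambda>x. x * h x) X - trf (\<lambda>a b. X a b - X' a b) (\<lambda>x. x * h x) X'
    \<le> (2 * q - 1) * (trf (sq (\<lambda>a b. X a b - X' a b)) h X + trf (sq (\<lambda>a b. X a b - X' a b)) h X')"
proof -
  have "trf (\<lambda>a b. X a b - X' a b) (\<lambda>x. x * h x) X - trf (\<lambda>a b. X a b - X' a b) (\<lambda>x. x * h x) X'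
     = dsum X X' (\<lambda>x y. (x - y) * (x * h x) - (x - y) * (y * h y))"
    unfolding trf_diff_dsum[OF X] dsum_diff by (rule refl)
  also have "\<dots> \<le> dsum X X' (\<lambda>x y. (2 * q - 1) * ((x - y)\<^sup>2 * h x + (x - y)\<^sup>2 * h y))"
    using odd_power_increment[OF q] by (intro dsum_mono) (simp add: h_def algebra_simps)
  also have "\<dots> = (2 * q - 1) * (trf (sq (\<lambda>a b. X a b - X' a b)) h X + trf (sq (\<lambda>a b. X a b - X' a b)) h X')"
    unfolding trf_diff_dsum[OF X] dsum_cmult dsum_add by (rule refl)
  finally show ?thesis .
qed

lemma trf_young_sq:
  assumes V: "psd V" and X: "sym_on I X" and q: "q \<ge> 1" and c: "c \<ge> 0"
  shows "c * trf V (\<lambda>x. (x\<^sup>2) powr (q - 1)) X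
    \<le> c powr q * tr1 (\<lambda>x. x powr q) V / q + (1 - 1 / q) * tr1 (\<lambda>x. (x\<^sup>2) powr q) X"
proof -
  note sV = psd_sym[OF V]
  have "c * trf V (\<lambda>x. (x\<^sup>2) powr (q - 1)) X = dsum V X (\<lambda>v x. c * (v * (x\<^sup>2) powr (q - 1)))"
    unfolding dsum_cmult trf_dsum[OF sV] by (rule refl)
  also have "\<dots> \<le> dsum V X (\<lambda>v x. c powr q / q * v powr q + (1 - 1 / q) * (x\<^sup>2) powr q)"
    unfolding dsum_def
  proof (intro sum_mono mult_right_mono wt_nonneg)
    fix i j assume "i \<in> I" "j \<in> I"
    then show "c * (ev V i * ((ev X j)\<^sup>2) powr (q - 1)) \<le> c powr q / q * ev V i powr q + (1 - 1 / q) * ((ev X j)\<^sup>2) powr q"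
      using powr_young[of "c * ev V i" "(ev X j)\<^sup>2" q] c q psd_ev_nonneg[OF V]
      by (simp add: powr_mult mult.assoc)
  qed
  also have "\<dots> = c powr q * tr1 (\<lambda>x. x powr q) V / q + (1 - 1 / q) * tr1 (\<lambda>x. (x\<^sup>2) powr q) X"
    unfolding dsum_add dsum_cmult dsum_left[OF sV X] dsum_right[OF sV X] by simp
  finally show ?thesis .
qed

text \<open>A discrete integration by parts. With X the signed sum, one factor X of tr |X|^(2q) is
  expanded into the terms \<epsilon>_j H_j; comparing X with its flip in coordinate j turns each
  term into a second order error tr H_j^2 h(X). Summed over j these errors give tr V h(X), where V
  does not depend on the signs.\<close>

lemma khinchine_upper:
  assumes H: "\<And>j. j \<in> {1..n} \<Longrightarrow> sym_on I (H j)" and S: "S \<subseteq> {1..n}" and q: "q \<ge> 1"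
  shows "(\<Sum>\<epsilon>\<in>sign_vectors n. tr1 (\<lambda>x. (x\<^sup>2) powr q) (\<lambda>a b. \<Sum>j\<in>S. \<epsilon> j * H j a b))
    \<le> 2 ^ n * ((2 * (2 * q - 1)) powr q * tr1 (\<lambda>x. x powr q) (\<lambda>a b. \<Sum>j\<in>S. sq (H j) a b))"
proof -
  define h where "h = (\<lambda>x::real. (x\<^sup>2) powr (q - 1))"
  define X where "X = (\<lambda>\<epsilon>::nat \<Rightarrow> real. \<lambda>a b. \<Sum>j\<in>S. \<epsilon> j * H j a b)"
  define V where "V = (\<lambda>a b. \<Sum>j\<in>S. sq (H j) a b)"
  define c where "c = 2 * (2 * q - 1)"
  define P where "P = (\<Sum>\<epsilon>\<in>sign_vectors n. tr1 (\<lambda>x. (x\<^sup>2) powr q) (X \<epsilon>))"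
  have finS: "finite S" using S finite_subset by blast
  have symX: "sym_on I (X \<epsilon>)" for \<epsilon>
    unfolding X_def using H S by (intro sym_on_sum) auto
  have V: "psd V" unfolding V_def using H S by (intro psd_sum psd_sq) auto
  have single: "(\<Sum>\<epsilon>\<in>sign_vectors n. \<epsilon> j * trf (H j) (\<lambda>x. x * h x) (X \<epsilon>))
      \<le> c * (\<Sum>\<epsilon>\<in>sign_vectors n. trf (sq (H j)) h (X \<epsilon>))" if j: "j \<in> S" for j
  proof -
    have jn: "j \<in> {1..n}" using j S by blast
    define fl where "fl = (\<lambda>\<epsilon>::nat \<Rightarrow> real. \<epsilon>(j := - \<epsilon> j))"
    have D: "X \<epsilon> a b - X (fl \<epsilon>) a b = 2 * \<epsilon> j * H j a b" for \<epsilon> a b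
    proof -
      have "X \<epsilon> a b - X (fl \<epsilon>) a b = (\<Sum>i\<in>S. if i = j then 2 * \<epsilon> j * H j a b else 0)"
        unfolding X_def sum_subtractf[symmetric] fl_def by (intro sum.cong refl) auto
      then show ?thesis using finS j by simp
    qed
    \<comment> \<open>Flipping the sign of \<open>\<epsilon> j\<close> turns the odd expression into an increment of the function.\<close>
    have step: "4 * (\<epsilon> j * (trf (H j) (\<lambda>x. x * h x) (X \<epsilon>) - trf (H j) (\<lambda>x. x * h x) (X (fl \<epsilon>))))
       \<le> 4 * c * (trf (sq (H j)) h (X \<epsilon>) + trf (sq (H j)) h (X (fl \<epsilon>)))" if \<epsilon>: "\<epsilon> \<in> sign_vectors n" for \<epsilon>
    proof -
      have sqD: "sq (\<lambda>a b. 2 * \<epsilon> j * H j a b) = (\<lambda>a b. 4 * sq (H j) a b)"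
      proof (intro ext)
        fix a b
        have "(2 * \<epsilon> j * x) * (2 * \<epsilon> j * y) = 4 * (x * y)" for x y
        proof -
          have "(2 * \<epsilon> j * x) * (2 * \<epsilon> j * y) = (\<epsilon> j * \<epsilon> j) * (4 * (x * y))" by simp
          then show ?thesis using sign_vectors_square[OF \<epsilon> jn] by simp
        qed
        then show "sq (\<lambda>a b. 2 * \<epsilon> j * H j a b) a b = 4 * sq (H j) a b"
          by (simp only: sq_def sum_distrib_left)
      qed
      show ?thesis
        using trf_odd_power_increment[OF symX symX q, of \<epsilon> "fl \<epsilon>"]
        unfolding D sqD trf_cmult c_def h_def by (simp add: algebra_simps)
    qed
    have flip: "(\<Sum>\<epsilon>\<in>sign_vectors n. f \<epsilon>) = (\<Sum>\<epsilon>\<in>sign_vectors n. f (fl \<epsilon>) :: real)" for f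
      unfolding fl_def by (rule sum_sign_vectors_flip[OF jn])
    have flj: "fl \<epsilon> j = - \<epsilon> j" for \<epsilon> by (simp add: fl_def)
    define L where "L = (\<Sum>\<epsilon>\<in>sign_vectors n. \<epsilon> j * trf (H j) (\<lambda>x. x * h x) (X \<epsilon>))"
    define R where "R = (\<Sum>\<epsilon>\<in>sign_vectors n. trf (sq (H j)) h (X \<epsilon>))"
    have L': "L = - (\<Sum>\<epsilon>\<in>sign_vectors n. \<epsilon> j * trf (H j) (\<lambda>x. x * h x) (X (fl \<epsilon>)))"
      unfolding L_def by (subst flip) (simp add: flj sum_negf)
    have R': "R = (\<Sum>\<epsilon>\<in>sign_vectors n. trf (sq (H j)) h (X (fl \<epsilon>)))"
      unfolding R_def by (rule flip)
    have "4 * (L + L) = (\<Sum>\<epsilon>\<in>sign_vectors n. 4 * (\<epsilon> j * (trf (H j) (\<lambda>x. x * h x) (X \<epsilon>) - trf (H j) (\<lambda>x. x * h x) (X (fl \<epsilon>)))))"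
      by (subst (2) L') (simp add: L_def right_diff_distrib sum_subtractf sum_distrib_left)
    also have "\<dots> \<le> (\<Sum>\<epsilon>\<in>sign_vectors n. 4 * c * (trf (sq (H j)) h (X \<epsilon>) + trf (sq (H j)) h (X (fl \<epsilon>))))"
      by (intro sum_mono step)
    also have "\<dots> = 4 * c * (R + R)"
      by (subst (2) R') (simp add: R_def sum.distrib flip: sum_distrib_left)
    finally show ?thesis unfolding L_def R_def by simp
  qed
  have "P = (\<Sum>\<epsilon>\<in>sign_vectors n. \<Sum>j\<in>S. \<epsilon> j * trf (H j) (\<lambda>x. x * h x) (X \<epsilon>))"
    unfolding P_def
  proof (intro sum.cong refl)
    fix \<epsilon>
    have "tr1 (\<lambda>x. (x\<^sup>2) powr q) (X \<epsilon>) = trf (X \<epsilon>) (\<lambda>x. x * h x) (X \<epsilon>)"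
      unfolding trf_self[OF symX] using mult_powr_minus_one[of "x\<^sup>2" q for x]
      by (simp add: h_def power2_eq_square mult.assoc)
    also have "\<dots> = (\<Sum>j\<in>S. \<epsilon> j * trf (H j) (\<lambda>x. x * h x) (X \<epsilon>))"
      by (subst (1) X_def) (rule trf_sum)
    finally show "tr1 (\<lambda>x. (x\<^sup>2) powr q) (X \<epsilon>) = (\<Sum>j\<in>S. \<epsilon> j * trf (H j) (\<lambda>x. x * h x) (X \<epsilon>))" .
  qed
  also have "\<dots> = (\<Sum>j\<in>S. \<Sum>\<epsilon>\<in>sign_vectors n. \<epsilon> j * trf (H j) (\<lambda>x. x * h x) (X \<epsilon>))" by (rule sum.swap)
  also have "\<dots> \<le> (\<Sum>j\<in>S. c * (\<Sum>\<epsilon>\<in>sign_vectors n. trf (sq (H j)) h (X \<epsilon>)))"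
    by (intro sum_mono single)
  also have "\<dots> = (\<Sum>\<epsilon>\<in>sign_vectors n. c * trf V h (X \<epsilon>))"
  proof -
    have "trf V h Y = (\<Sum>j\<in>S. trf (sq (H j)) h Y)" for Y
      using trf_sum[of "\<lambda>_. 1" "\<lambda>j. sq (H j)" S h Y] by (simp add: V_def)
    then show ?thesis by (simp add: sum_distrib_left) (rule sum.swap)
  qed
  \<comment> \<open>Young's inequality returns the share \<open>1 - 1 / q\<close> of
    \<open>P\<close>; moved to the left it leaves \<open>P / q\<close>, and the common factor 1/q
    cancels.\<close>
  also have "\<dots> \<le> (\<Sum>\<epsilon>\<in>sign_vectors n. c powr q * tr1 (\<lambda>x. x powr q) V / q + (1 - 1 / q) * tr1 (\<lambda>x. (x\<^sup>2) powr q) (X \<epsilon>))"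
    unfolding h_def using q by (intro sum_mono trf_young_sq V symX) (auto simp: c_def)
  also have "\<dots> = 2 ^ n * (c powr q * tr1 (\<lambda>x. x powr q) V) / q + (1 - 1 / q) * P"
    by (simp add: sum.distrib card_sign_vectors P_def sum_distrib_left)
  finally have "P / q \<le> 2 ^ n * (c powr q * tr1 (\<lambda>x. x powr q) V) / q"
    by (simp add: left_diff_distrib)
  then have "P \<le> 2 ^ n * (c powr q * tr1 (\<lambda>x. x powr q) V)"
    using q by (simp add: divide_le_cancel)
  then show ?thesis unfolding P_def V_def X_def c_def .
qed

lemma sq_signed_sum_average:
  assumes "S \<subseteq> {1..n}"
  shows "(\<Sum>\<epsilon>\<in>sign_vectors n. sq (\<lambda>a b. \<Sum>j\<in>S. \<epsilon> j * H j a b) a b) = 2 ^ n * (\<Sum>j\<in>S. sq (H j) a b)"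
proof -
  have finS: "finite S" using assms finite_subset by blast
  have "(\<Sum>\<epsilon>\<in>sign_vectors n. sq (\<lambda>a b. \<Sum>j\<in>S. \<epsilon> j * H j a b) a b)
     = (\<Sum>\<epsilon>\<in>sign_vectors n. \<Sum>c\<in>I. \<Sum>j\<in>S. \<Sum>k\<in>S. (\<epsilon> j * \<epsilon> k) * (H j a c * H k c b))"
    unfolding sq_def sum_product by (simp add: mult_ac)
  also have "\<dots> = (\<Sum>c\<in>I. \<Sum>\<epsilon>\<in>sign_vectors n. \<Sum>j\<in>S. \<Sum>k\<in>S. (\<epsilon> j * \<epsilon> k) * (H j a c * H k c b))"
    by (rule sum.swap)
  also have "\<dots> = (\<Sum>c\<in>I. \<Sum>j\<in>S. \<Sum>k\<in>S. (\<Sum>\<epsilon>\<in>sign_vectors n. \<epsilon> j * \<epsilon> k) * (H j a c * H k c b))"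
  proof (intro sum.cong refl)
    fix c
    have "(\<Sum>\<epsilon>\<in>sign_vectors n. \<Sum>j\<in>S. \<Sum>k\<in>S. (\<epsilon> j * \<epsilon> k) * (H j a c * H k c b))
      = (\<Sum>j\<in>S. \<Sum>\<epsilon>\<in>sign_vectors n. \<Sum>k\<in>S. (\<epsilon> j * \<epsilon> k) * (H j a c * H k c b))" by (rule sum.swap)
    also have "\<dots> = (\<Sum>j\<in>S. \<Sum>k\<in>S. \<Sum>\<epsilon>\<in>sign_vectors n. (\<epsilon> j * \<epsilon> k) * (H j a c * H k c b))"
      by (intro sum.cong refl sum.swap)
    finally show "(\<Sum>\<epsilon>\<in>sign_vectors n. \<Sum>j\<in>S. \<Sum>k\<in>S. (\<epsilon> j * \<epsilon> k) * (H j a c * H k c b))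
      = (\<Sum>j\<in>S. \<Sum>k\<in>S. (\<Sum>\<epsilon>\<in>sign_vectors n. \<epsilon> j * \<epsilon> k) * (H j a c * H k c b))"
      by (simp only: sum_distrib_right)
  qed
  also have "\<dots> = (\<Sum>c\<in>I. \<Sum>j\<in>S. \<Sum>k\<in>S. if j = k then 2 ^ n * (H j a c * H k c b) else 0)"
    using assms by (intro sum.cong refl) (auto simp: sum_sign_vectors_mult subset_eq)
  also have "\<dots> = (\<Sum>c\<in>I. \<Sum>j\<in>S. 2 ^ n * (H j a c * H j c b))"
    using finS by (intro sum.cong refl) simp
  also have "\<dots> = 2 ^ n * (\<Sum>j\<in>S. sq (H j) a b)"
    by (subst sum.swap) (simp add: sq_def sum_distrib_left)
  finally show ?thesis .
qed

text \<open>Jensen's inequality: the squares of the signed sums average to \<open>V\<close>, so the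
  linear terms of the tangents taken at \<open>V\<close> cancel.\<close>

lemma khinchine_lower:
  assumes H: "\<And>j. j \<in> {1..n} \<Longrightarrow> sym_on I (H j)" and S: "S \<subseteq> {1..n}" and q: "q \<ge> 1"
  shows "2 ^ n * tr1 (\<lambda>x. x powr q) (\<lambda>a b. \<Sum>j\<in>S. sq (H j) a b)
    \<le> (\<Sum>\<epsilon>\<in>sign_vectors n. tr1 (\<lambda>x. (x\<^sup>2) powr q) (\<lambda>a b. \<Sum>j\<in>S. \<epsilon> j * H j a b))"
proof -
  define X where "X = (\<lambda>\<epsilon>::nat \<Rightarrow> real. \<lambda>a b. \<Sum>j\<in>S. \<epsilon> j * H j a b)"
  define V where "V = (\<lambda>a b. \<Sum>j\<in>S. sq (H j) a b)"
  have symX: "sym_on I (X \<epsilon>)" for \<epsilon>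
    unfolding X_def using H S by (intro sym_on_sum) auto
  have V: "psd V" unfolding V_def using H S by (intro psd_sum psd_sq) auto
  define W where "W = (\<lambda>\<epsilon> a b. sq (X \<epsilon>) a b - V a b)"
  have "(\<Sum>\<epsilon>\<in>sign_vectors n. W \<epsilon> a b) = 0" for a b
    using sq_signed_sum_average[OF S, of H a b]
    by (simp add: W_def X_def V_def sum_subtractf card_sign_vectors)
  then have W0: "(\<Sum>\<epsilon>\<in>sign_vectors n. trf (W \<epsilon>) f V) = 0" for f
    using trf_sum[of "\<lambda>_. 1" W "sign_vectors n" f V] by (simp add: trf_def qform_def)
  have "2 ^ n * tr1 (\<lambda>x. x powr q) V = (\<Sum>\<epsilon>\<in>sign_vectors n. tr1 (\<lambda>x. x powr q) V + q * trf (W \<epsilon>) (\<lambda>z. z powr (q - 1)) V)"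
    by (simp add: sum.distrib card_sign_vectors W0 flip: sum_distrib_left)
  also have "\<dots> \<le> (\<Sum>\<epsilon>\<in>sign_vectors n. tr1 (\<lambda>x. x powr q) (sq (X \<epsilon>)))"
    unfolding W_def by (intro sum_mono tr1_powr_tangent psd_sq symX V q)
  also have "\<dots> = (\<Sum>\<epsilon>\<in>sign_vectors n. tr1 (\<lambda>x. (x\<^sup>2) powr q) (X \<epsilon>))"
    by (intro sum.cong refl tr1_sq symX)
  finally show ?thesis unfolding V_def X_def .
qed

end

section \<open>A Rosenthal inequality for random subsets\<close>

lemma card_subsets_containing:
  assumes "finite A" "j \<in> A" "1 \<le> k"
  shows "card {S. S \<subseteq> A \<and> card S = k \<and> j \<in> S} = (card A - 1) choose (k - 1)"
proof -
  have "bij_betw (\<lambda>S. S - {j}) {S. S \<subseteq> A \<and> card S = k \<and> j \<in> S} {T. T \<subseteq> A - {j} \<and> card T = k - 1}"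
  proof (rule bij_betw_byWitness[where f' = "insert j"])
    show "insert j ` {T. T \<subseteq> A - {j} \<and> card T = k - 1} \<subseteq> {S. S \<subseteq> A \<and> card S = k \<and> j \<in> S}"
    proof clarify
      fix T assume T: "T \<subseteq> A - {j}" "card T = k - 1"
      then have "finite T" "j \<notin> T" using assms(1) by (auto intro: finite_subset)
      then have "card (insert j T) = k" using T assms(3) by simp
      then show "insert j T \<subseteq> A \<and> card (insert j T) = k \<and> j \<in> insert j T" using T assms(2) by auto
    qed
  qed (auto simp: card_Diff_singleton)
  then have "card {S. S \<subseteq> A \<and> card S = k \<and> j \<in> S} = card {T. T \<subseteq> A - {j} \<and> card T = k - 1}"
    by (rule bij_betw_same_card)
  also have "\<dots> = card (A - {j}) choose (k - 1)" using assms by (intro n_subsets) auto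
  finally show ?thesis using assms by (simp add: card_Diff_singleton)
qed

lemma finite_card_subsets: "finite A \<Longrightarrow> finite {S. S \<subseteq> A \<and> card S = k}"
  by (rule finite_subset[of _ "Pow A"]) auto

lemma sum_subsets_elements:
  fixes t :: "'b \<Rightarrow> real"
  assumes "finite A" "1 \<le> k"
  shows "(\<Sum>S\<in>{S. S \<subseteq> A \<and> card S = k}. \<Sum>j\<in>S. t j) = real ((card A - 1) choose (k - 1)) * (\<Sum>j\<in>A. t j)"
proof -
  let ?K = "{S. S \<subseteq> A \<and> card S = k}"
  have "(\<Sum>S\<in>?K. \<Sum>j\<in>S. t j) = (\<Sum>S\<in>?K. \<Sum>j\<in>A. if j \<in> S then t j else 0)"
  proof (rule sum.cong[OF refl])
    fix S assume "S \<in> ?K"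
    then have "A \<inter> S = S" by auto
    then show "(\<Sum>j\<in>S. t j) = (\<Sum>j\<in>A. if j \<in> S then t j else 0)"
      using sum.inter_restrict[OF assms(1), of t S] by simp
  qed
  also have "\<dots> = (\<Sum>j\<in>A. \<Sum>S\<in>?K. if j \<in> S then t j else 0)" by (rule sum.swap)
  also have "\<dots> = (\<Sum>j\<in>A. real ((card A - 1) choose (k - 1)) * t j)"
  proof (intro sum.cong refl)
    fix j assume j: "j \<in> A"
    have "(\<Sum>S\<in>?K. if j \<in> S then t j else 0) = (\<Sum>S\<in>{S\<in>?K. j \<in> S}. t j)"
      using finite_card_subsets[OF assms(1)] by (rule sum.inter_filter[symmetric])
    also have "{S\<in>?K. j \<in> S} = {S. S \<subseteq> A \<and> card S = k \<and> j \<in> S}" by auto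
    finally show "(\<Sum>S\<in>?K. if j \<in> S then t j else 0) = real ((card A - 1) choose (k - 1)) * t j"
      by (simp add: card_subsets_containing[OF assms(1) j assms(2)])
  qed
  finally show ?thesis by (simp add: sum_distrib_left)
qed

text \<open>Pairs of a set and one of its elements correspond to pairs of a set and an element
  outside it. This replaces independence: after the exchange, \<open>j\<close> ranges over
  everything outside the set at which the summand is evaluated.\<close>

lemma sum_subsets_remove:
  fixes t :: "'b \<Rightarrow> 'b set \<Rightarrow> real"
  assumes "finite A"
  shows "(\<Sum>S\<in>{S. S \<subseteq> A \<and> card S = Suc k}. \<Sum>j\<in>S. t j (S - {j}))
    = (\<Sum>T\<in>{T. T \<subseteq> A \<and> card T = k}. \<Sum>j\<in>A - T. t j T)"
proof -
  have fin: "finite S" if "S \<subseteq> A" for S using that assms finite_subset by blast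
  have "(\<Sum>S\<in>{S. S \<subseteq> A \<and> card S = Suc k}. \<Sum>j\<in>S. t j (S - {j}))
      = (\<Sum>(S, j)\<in>(SIGMA S:{S. S \<subseteq> A \<and> card S = Suc k}. S). t j (S - {j}))"
    using finite_card_subsets[OF assms] fin by (intro sum.Sigma) auto
  also have "\<dots> = (\<Sum>(T, j)\<in>(SIGMA T:{T. T \<subseteq> A \<and> card T = k}. A - T). t j T)"
    by (rule sum.reindex_bij_witness[where i = "\<lambda>(T, j). (insert j T, j)" and j = "\<lambda>(S, j). (S - {j}, j)"])
       (auto simp: fin card_Diff_singleton card_insert_if)
  also have "\<dots> = (\<Sum>T\<in>{T. T \<subseteq> A \<and> card T = k}. \<Sum>j\<in>A - T. t j T)"
    using finite_card_subsets[OF assms] assms by (intro sum.Sigma[symmetric]) auto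
  finally show ?thesis .
qed

context finite_index
begin

lemma tr1_zero: assumes "f 0 = 0" shows "tr1 f (\<lambda>a b. 0) = 0"
proof -
  have "ev (\<lambda>a b. 0) j = 0" if "j \<in> I" for j
    using qform_ev[of "\<lambda>a b. 0" j] that by (simp add: sym_on_def qform_def)
  then show ?thesis using assms by (simp add: tr1_def)
qed

text \<open>With Y_S the sum of the B_j over S, tr Y_S^q is the sum over j in S of tr B_j Y_S^(q-1).
  \<open>key\<close> removes B_j from the power, the exchange of pairs passes to subsets T with one
  element less, and the sum over j recombines to tr Y_A Y_T^(q-1), to which Young's inequality
  applies.\<close>

lemma rosenthal_psd_subsets_small:
  fixes B :: "'b \<Rightarrow> 'i \<Rightarrow> 'i \<Rightarrow> real"
  assumes A: "finite A" and B: "\<And>j. j \<in> A \<Longrightarrow> psd (B j)" and q: "q \<ge> 1" and K: "K \<ge> 0" and L: "L \<ge> 0"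
    and key: "\<And>j Z. j \<in> A \<Longrightarrow> psd Z \<Longrightarrow>
       trf (B j) (\<lambda>y. y powr (q - 1)) (\<lambda>a b. Z a b + B j a b)
         \<le> K * trf (B j) (\<lambda>y. y powr (q - 1)) Z + L * tr1 (\<lambda>x. x powr q) (B j)"
  shows "2 * k \<le> card A \<Longrightarrow>
    (\<Sum>S\<in>{S. S \<subseteq> A \<and> card S = k}. tr1 (\<lambda>x. x powr q) (\<lambda>a b. \<Sum>j\<in>S. B j a b))
    \<le> real (card A choose k) *
       ((2 * K * (real k / real (card A))) powr q * tr1 (\<lambda>x. x powr q) (\<lambda>a b. \<Sum>j\<in>A. B j a b)
        + q * L * (real k / real (card A)) * (\<Sum>j\<in>A. tr1 (\<lambda>x. x powr q) (B j)))"
proof (induction k)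
  case 0
  have "{S. S \<subseteq> A \<and> card S = 0} = {{}}" using A by (auto dest: finite_subset)
  then show ?case by (simp add: tr1_zero)
next
  case (Suc k)
  define n where "n = card A"
  define Y where "Y = (\<lambda>S a b. \<Sum>j\<in>S. B j a b)"
  define f where "f = (\<lambda>y::real. y powr (q - 1))"
  define \<tau> where "\<tau> = tr1 (\<lambda>x. x powr q)"
  define \<alpha> where "\<alpha> = \<tau> (Y A)"
  define \<beta> where "\<beta> = (\<Sum>j\<in>A. \<tau> (B j))"
  define N where "N = (\<lambda>k. {S. S \<subseteq> A \<and> card S = k})"
  define C where "C = (\<lambda>k. real (n choose k))"
  have n: "n > 0" "Suc k \<le> n" using Suc.prems by (auto simp: n_def)
  have finS: "finite S" if "S \<subseteq> A" for S using that A finite_subset by blast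
  have \<tau>nn: "\<tau> M \<ge> 0" for M by (simp add: \<tau>_def tr1_def sum_nonneg)
  have \<beta>: "\<beta> \<ge> 0" by (simp add: \<beta>_def sum_nonneg \<tau>nn)
  have psdY: "psd (Y S)" if "S \<subseteq> A" for S
    unfolding Y_def using that B by (intro psd_sum) auto
  have trfY: "trf (Y S) f M = (\<Sum>j\<in>S. trf (B j) f M)" for S M
    using trf_sum[of "\<lambda>_. 1" B S f M] by (simp add: Y_def)
  have Ck: "C k > 0" using n by (simp add: C_def)
  have CSuc: "C (Suc k) * real (Suc k) = C k * real (n - k)"
    using binomial_absorb_comp[of n k] binomial_absorption[of k n] 
    by (metis C_def mult.commute of_nat_mult Suc_times_binomial_add binomial_absorb_comp)
  have Cn: "real ((n - 1) choose k) = C (Suc k) * (real (Suc k) / real n)"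
    using n binomial_absorption[of k n] unfolding C_def
    by (simp add: field_simps flip: of_nat_mult of_nat_Suc)
  have one: "(\<Sum>S\<in>N (Suc k). \<tau> (Y S))
     \<le> (\<Sum>S\<in>N (Suc k). \<Sum>j\<in>S. K * trf (B j) f (Y (S - {j}))) + (\<Sum>S\<in>N (Suc k). \<Sum>j\<in>S. L * \<tau> (B j))"
    unfolding sum.distrib[symmetric]
  proof (intro sum_mono)
    fix S assume S: "S \<in> N (Suc k)"
    then have SA: "S \<subseteq> A" by (simp add: N_def)
    have "\<tau> (Y S) = trf (Y S) f (Y S)"
      unfolding trf_self[OF psd_sym[OF psdY[OF SA]]] \<tau>_def tr1_def f_def
      using psd_ev_nonneg[OF psdY[OF SA]] by (intro sum.cong) (simp_all add: mult_powr_minus_one)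
    also have "\<dots> = (\<Sum>j\<in>S. trf (B j) f (Y S))" by (rule trfY)
    also have "\<dots> \<le> (\<Sum>j\<in>S. K * trf (B j) f (Y (S - {j})) + L * \<tau> (B j))"
    proof (intro sum_mono)
      fix j assume j: "j \<in> S"
      have "Y S = (\<lambda>a b. Y (S - {j}) a b + B j a b)"
        unfolding Y_def using sum.remove[OF finS[OF SA] j] by (intro ext) (simp add: add.commute)
      then show "trf (B j) f (Y S) \<le> K * trf (B j) f (Y (S - {j})) + L * \<tau> (B j)"
        using key[of j "Y (S - {j})"] j SA psdY[of "S - {j}"] unfolding f_def \<tau>_def by auto
    qed
    finally show "\<tau> (Y S) \<le> (\<Sum>j\<in>S. K * trf (B j) f (Y (S - {j})) + L * \<tau> (B j))" .
  qed
  have two: "(\<Sum>S\<in>N (Suc k). \<Sum>j\<in>S. L * \<tau> (B j)) = C (Suc k) * (L * (real (Suc k) / real n) * \<beta>)"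
    using sum_subsets_elements[OF A, of "Suc k" "\<lambda>j. L * \<tau> (B j)"] Cn
    by (simp add: N_def \<beta>_def sum_distrib_left n_def mult_ac)
  \<comment> \<open>The ratio of the numbers of subsets of sizes \<open>Suc k\<close> and
    \<open>k\<close>. Factoring it out before Young's inequality lets the sum over
    \<open>N k\<close> carry the total weight \<open>C (Suc k)\<close>.\<close>
  define \<kappa> where "\<kappa> = real (n - k) / real (Suc k)"
  have \<kappa>: "\<kappa> > 0" using n by (simp add: \<kappa>_def)
  have \<kappa>C: "\<kappa> * C k = C (Suc k)" using CSuc by (simp add: \<kappa>_def field_simps del: of_nat_Suc)
  \<comment> \<open>The assumption that \<open>Suc k\<close> is at most half of \<open>n\<close>
    enters here, through \<open>n \<le> 2 * (n - k)\<close>; it causes the 2 in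
    \<open>2 * K\<close>.\<close>
  have K\<kappa>: "K / \<kappa> \<le> 2 * K * (real (Suc k) / real n)"
  proof -
    have "1 / real (n - k) \<le> 2 / real n"
      using Suc.prems n by (simp add: n_def field_simps)
    then have "K * real (Suc k) * (1 / real (n - k)) \<le> K * real (Suc k) * (2 / real n)"
      using K by (intro mult_left_mono) auto
    then show ?thesis by (simp add: \<kappa>_def field_simps)
  qed
  define \<rho> where "\<rho> = (2 * K * (real (Suc k) / real n)) powr q * \<alpha>"
  have K\<kappa>q: "(K / \<kappa>) powr q * \<alpha> \<le> \<rho>"
    unfolding \<rho>_def using K\<kappa> K \<kappa> q \<tau>nn by (intro mult_right_mono powr_mono2) (auto simp: \<alpha>_def)
  have three: "(\<Sum>S\<in>N (Suc k). \<Sum>j\<in>S. K * trf (B j) f (Y (S - {j}))) \<le> \<kappa> * (\<Sum>T\<in>N k. \<rho> / q + (1 - 1 / q) * \<tau> (Y T))"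
  proof -
    have "(\<Sum>S\<in>N (Suc k). \<Sum>j\<in>S. K * trf (B j) f (Y (S - {j}))) = (\<Sum>T\<in>N k. \<Sum>j\<in>A - T. K * trf (B j) f (Y T))"
      unfolding N_def by (rule sum_subsets_remove[OF A, of "\<lambda>j S. K * trf (B j) f (Y S)"])
    also have "\<dots> \<le> (\<Sum>T\<in>N k. \<kappa> * (\<rho> / q + (1 - 1 / q) * \<tau> (Y T)))"
    proof (intro sum_mono)
      fix T assume "T \<in> N k"
      then have TA: "T \<subseteq> A" by (simp add: N_def)
      \<comment> \<open>The terms with \<open>j\<close> in \<open>T\<close> are nonnegative, so
        adding them completes the sum to the fixed matrix \<open>Y A\<close>.\<close>
      have "(\<Sum>j\<in>A - T. K * trf (B j) f (Y T)) \<le> (\<Sum>j\<in>A. K * trf (B j) f (Y T))"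
        using A K B by (intro sum_mono2) (auto intro!: mult_nonneg_nonneg trf_nonneg simp: f_def)
      also have "\<dots> = \<kappa> * (K / \<kappa> * trf (Y A) f (Y T))"
        using \<kappa> by (simp add: trfY sum_distrib_left)
      also have "\<dots> \<le> \<kappa> * ((K / \<kappa>) powr q * \<alpha> / q + (1 - 1 / q) * \<tau> (Y T))"
        unfolding f_def \<alpha>_def \<tau>_def using \<kappa> K q TA by (intro mult_left_mono trf_young psdY) auto
      also have "\<dots> \<le> \<kappa> * (\<rho> / q + (1 - 1 / q) * \<tau> (Y T))"
        using \<kappa> q K\<kappa>q by (intro mult_left_mono add_right_mono divide_right_mono) auto
      finally show "(\<Sum>j\<in>A - T. K * trf (B j) f (Y T)) \<le> \<kappa> * (\<rho> / q + (1 - 1 / q) * \<tau> (Y T))" .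
    qed
    finally show ?thesis by (simp add: sum_distrib_left)
  qed
  have cardN: "real (card (N k)) = C k"
    unfolding N_def C_def n_def using n_subsets[OF A, of k] by simp
  have IH: "(\<Sum>T\<in>N k. \<tau> (Y T)) \<le> C k * ((2 * K * (real k / real n)) powr q * \<alpha> + q * L * (real k / real n) * \<beta>)"
    using Suc.IH Suc.prems unfolding N_def \<tau>_def Y_def C_def n_def \<alpha>_def \<beta>_def by simp
  also have "\<dots> \<le> C k * (\<rho> + q * L * (real (Suc k) / real n) * \<beta>)"
    unfolding \<rho>_def using q K L \<beta> \<tau>nn Ck n
    by (intro mult_left_mono add_mono mult_right_mono powr_mono2 divide_right_mono) (auto simp: \<alpha>_def)
  finally have IH': "(\<Sum>T\<in>N k. \<tau> (Y T)) \<le> C k * (\<rho> + q * L * (real (Suc k) / real n) * \<beta>)" .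
  define \<eta> where "\<eta> = L * (real (Suc k) / real n) * \<beta>"
  \<comment> \<open>The weights close the induction: \<rho>/q + (1 - 1/q)(\<rho> + q \<eta>) =
    \<rho> + (q - 1) \<eta>, and the separate \<eta> of the present step restores q \<eta>. Hence
    the factor \<open>q\<close> in front of \<open>L\<close>.\<close>
  have "(\<Sum>T\<in>N k. \<rho> / q + (1 - 1 / q) * \<tau> (Y T)) = C k * (\<rho> / q) + (1 - 1 / q) * (\<Sum>T\<in>N k. \<tau> (Y T))"
    by (simp add: sum.distrib cardN sum_distrib_left)
  also have "\<dots> \<le> C k * (\<rho> / q) + (1 - 1 / q) * (C k * (\<rho> + q * \<eta>))"
    using IH' q by (intro add_left_mono mult_left_mono) (auto simp: \<eta>_def mult.assoc)
  also have "\<dots> = C k * (\<rho> + (q - 1) * \<eta>)"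
    using q by (simp add: field_simps)
  finally have "\<kappa> * (\<Sum>T\<in>N k. \<rho> / q + (1 - 1 / q) * \<tau> (Y T)) \<le> \<kappa> * (C k * (\<rho> + (q - 1) * \<eta>))"
    using \<kappa> by (intro mult_left_mono) auto
  also have "\<dots> = C (Suc k) * (\<rho> + (q - 1) * \<eta>)" by (simp add: \<kappa>C flip: mult.assoc)
  finally have "(\<Sum>S\<in>N (Suc k). \<tau> (Y S)) \<le> C (Suc k) * (\<rho> + (q - 1) * \<eta>) + C (Suc k) * \<eta>"
    using one two three unfolding \<eta>_def by linarith
  also have "\<dots> = C (Suc k) * (\<rho> + q * \<eta>)" by (simp add: algebra_simps)
  finally show ?case
    unfolding N_def \<tau>_def Y_def C_def n_def \<alpha>_def \<beta>_def \<eta>_def \<rho>_def by (simp add: mult.assoc)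
qed

text \<open>Beyond half of the elements the factor \<open>2 * K * (k / card A)\<close> is at least
  1, thanks to \<open>K \<ge> 1\<close>, so it is enough to bound each partial sum by the full one
  with \<open>tr1_powr_mono\<close>.\<close>

lemma rosenthal_psd_subsets:
  fixes B :: "'b \<Rightarrow> 'i \<Rightarrow> 'i \<Rightarrow> real"
  assumes A: "finite A" and B: "\<And>j. j \<in> A \<Longrightarrow> psd (B j)" and q: "q \<ge> 1" and K: "K \<ge> 1" and L: "L \<ge> 0"
    and key: "\<And>j Z. j \<in> A \<Longrightarrow> psd Z \<Longrightarrow>
       trf (B j) (\<lambda>y. y powr (q - 1)) (\<lambda>a b. Z a b + B j a b)
         \<le> K * trf (B j) (\<lambda>y. y powr (q - 1)) Z + L * tr1 (\<lambda>x. x powr q) (B j)"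
    and k: "k \<le> card A"
  shows "(\<Sum>S\<in>{S. S \<subseteq> A \<and> card S = k}. tr1 (\<lambda>x. x powr q) (\<lambda>a b. \<Sum>j\<in>S. B j a b))
    \<le> real (card A choose k) *
       ((2 * K * (real k / real (card A))) powr q * tr1 (\<lambda>x. x powr q) (\<lambda>a b. \<Sum>j\<in>A. B j a b)
        + q * L * (real k / real (card A)) * (\<Sum>j\<in>A. tr1 (\<lambda>x. x powr q) (B j)))"
proof (cases "2 * k \<le> card A")
  case True
  then show ?thesis using K by (intro rosenthal_psd_subsets_small A B q L key) auto
next
  case False
  define \<alpha> where "\<alpha> = tr1 (\<lambda>x. x powr q) (\<lambda>a b. \<Sum>j\<in>A. B j a b)"
  have \<alpha>: "\<alpha> \<ge> 0" by (simp add: \<alpha>_def tr1_def sum_nonneg)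
  have "1 \<le> 2 * (real k / real (card A))" using False k by (simp add: field_simps)
  then have "1 * 1 \<le> K * (2 * (real k / real (card A)))" using K by (intro mult_mono) auto
  then have "1 powr q \<le> (2 * K * (real k / real (card A))) powr q"
    using q by (intro powr_mono2) (auto simp: mult_ac)
  then have "1 * \<alpha> \<le> (2 * K * (real k / real (card A))) powr q * \<alpha>"
    using \<alpha> by (intro mult_right_mono) auto
  moreover have "0 \<le> q * L * (real k / real (card A)) * (\<Sum>j\<in>A. tr1 (\<lambda>x. x powr q) (B j))"
    using q L by (intro mult_nonneg_nonneg) (auto simp: tr1_def sum_nonneg)
  ultimately have le: "\<alpha> \<le> (2 * K * (real k / real (card A))) powr q * \<alpha>
        + q * L * (real k / real (card A)) * (\<Sum>j\<in>A. tr1 (\<lambda>x. x powr q) (B j))" by linarith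
  have "(\<Sum>S\<in>{S. S \<subseteq> A \<and> card S = k}. tr1 (\<lambda>x. x powr q) (\<lambda>a b. \<Sum>j\<in>S. B j a b))
     \<le> (\<Sum>S\<in>{S. S \<subseteq> A \<and> card S = k}. \<alpha>)"
  proof (intro sum_mono)
    fix S assume "S \<in> {S. S \<subseteq> A \<and> card S = k}"
    then have S: "S \<subseteq> A" by simp
    have "(\<lambda>a b. \<Sum>j\<in>A. B j a b) = (\<lambda>a b. (\<Sum>j\<in>S. B j a b) + (\<Sum>j\<in>A - S. B j a b))"
      by (intro ext, subst sum.subset_diff[OF S A]) (rule add.commute)
    moreover have "psd (\<lambda>a b. \<Sum>j\<in>A - S. B j a b)" "psd (\<lambda>a b. \<Sum>j\<in>S. B j a b)"
      using B S by (auto intro!: psd_sum)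
    ultimately show "tr1 (\<lambda>x. x powr q) (\<lambda>a b. \<Sum>j\<in>S. B j a b) \<le> \<alpha>"
      unfolding \<alpha>_def using tr1_powr_mono q by simp
  qed
  also have "\<dots> = real (card A choose k) * \<alpha>" using n_subsets[OF A, of k] by simp
  also have "\<dots> \<le> real (card A choose k) * ((2 * K * (real k / real (card A))) powr q * \<alpha>
        + q * L * (real k / real (card A)) * (\<Sum>j\<in>A. tr1 (\<lambda>x. x powr q) (B j)))"
    by (intro mult_left_mono le) auto
  finally show ?thesis unfolding \<alpha>_def .
qed

end

section \<open>Symmetric matrices\<close>

text \<open>With \<open>p = 2q\<close>, the threshold \<open>s = ln p / (2p)\<close> is as large as possible, up to a factor,
  subject to \<open>exp (s q)\<close> being a small power of \<open>p\<close> (here at most \<open>p\<close> to the power 1/4); the leading constant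
  \<open>4/s = 8p / ln p\<close> is where the logarithm is gained.\<close>

lemma rosenthal_constants:
  fixes q :: real
  assumes q: "q \<ge> 2"
  defines "s \<equiv> ln (2 * q) / (4 * q)"
  defines "K \<equiv> 2 + (q - 1) * exp (s * (q - 1)) * s / 2"
    and "L \<equiv> (4 / s) powr (q - 2) * (4 / s + 2 * (q - 1) * exp (s * (q - 1)))"
  shows "0 < s" "s \<le> 1" "1 \<le> K" "0 \<le> L"
    "2 * (2 * q - 1) * (2 * K) * (ln (2 * q) / (2 * q)\<^sup>2) \<le> 1024"
    "(2 * (2 * q - 1) * (ln (2 * q) / (2 * q)\<^sup>2)) powr q * (q * L) \<le> 1024 powr q"
proof -
  define p where "p = 2 * q"
  define E where "E = exp (ln p / 4)"
  define l where "l = ln p"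
  have p: "p \<ge> 4" using q by (simp add: p_def)
  have l0: "l > 0" using p by (simp add: l_def)
  have E1: "E \<ge> 1" using p by (simp add: E_def)
  \<comment> \<open>\<open>E\<close> is the fourth root of \<open>p\<close>. It bounds
    \<open>exp (s * (q - 1))\<close>, and \<open>l \<le> 4 * E\<close> lets it absorb logarithms as
    well.\<close>
  have "E ^ 4 = exp (real 4 * (ln p / 4))" unfolding E_def exp_of_nat_mult by simp
  also have "\<dots> = p" using p by simp
  finally have E4: "E ^ 4 = p" .
  have lE: "l \<le> 4 * E"
    using exp_ge_add_one_self[of "l / 4"] unfolding E_def l_def by linarith
  have lp: "l \<le> p" unfolding l_def using ln_le_minus_one[of p] p by simp
  have EE: "1 * E \<le> E ^ 3 * E" "1 * E ^ 3 \<le> E * E ^ 3"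
    using E1 by (auto intro!: mult_right_mono one_le_power)
  then have Ep: "E \<le> p" "E ^ 3 \<le> p" using E4 by (simp_all add: eval_nat_numeral)
  have s: "s = l / (2 * p)" by (simp add: s_def l_def p_def)
  show s0: "0 < s" using l0 p by (simp add: s)
  show s1: "s \<le> 1" using lp p by (simp add: s field_simps)
  have sr: "s * (q - 1) \<le> l / 4"
  proof -
    have "s * (q - 1) \<le> s * (p / 2)" using s0 by (intro mult_left_mono) (auto simp: p_def)
    also have "\<dots> = l / 4" using p by (simp add: s)
    finally show ?thesis .
  qed
  then have ex: "exp (s * (q - 1)) \<le> E" by (simp add: E_def l_def)
  have prod: "(q - 1) * exp (s * (q - 1)) * s \<le> l / 4 * E"
  proof -
    have "(q - 1) * exp (s * (q - 1)) * s = (s * (q - 1)) * exp (s * (q - 1))" by simp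
    also have "\<dots> \<le> l / 4 * E" using sr ex s0 q l0 by (intro mult_mono) auto
    finally show ?thesis .
  qed
  show "1 \<le> K" unfolding K_def using q s0 by simp
  show "0 \<le> L" unfolding L_def using q s0 by simp
  have a: "2 * (2 * q - 1) * (ln (2 * q) / (2 * q)\<^sup>2) \<le> 2 * l / p"
  proof -
    have "2 * (2 * q - 1) * (ln (2 * q) / (2 * q)\<^sup>2) \<le> 2 * p * (l / p\<^sup>2)"
      unfolding l_def p_def using p by (intro mult_right_mono) (auto simp: p_def)
    also have "\<dots> = 2 * l / p" using p by (simp add: power2_eq_square)
    finally show ?thesis .
  qed
  have a0: "0 \<le> 2 * (2 * q - 1) * (ln (2 * q) / (2 * q)\<^sup>2)" using q by simp
  have K: "2 * K \<le> 4 + l * E / 4" using prod by (simp add: K_def)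
  have "2 * (2 * q - 1) * (ln (2 * q) / (2 * q)\<^sup>2) * (2 * K) \<le> (2 * l / p) * (4 + l * E / 4)"
    using a0 a K l0 E1 p \<open>1 \<le> K\<close> by (intro mult_mono) auto
  also have "\<dots> = (8 * l + l\<^sup>2 * E / 2) / p"
    using p by (simp add: divide_simps power2_eq_square) (simp add: algebra_simps)
  \<comment> \<open>The logarithms are traded for \<open>E\<close>: \<open>l\<^sup>2 * E\<close> is
    at most 16 E^3, hence at most 16 p because p = E^4.\<close>
  also have "\<dots> \<le> (8 * p + 8 * p) / p"
  proof (intro divide_right_mono add_mono)
    have "l\<^sup>2 * E / 2 \<le> (4 * E)\<^sup>2 * E / 2" using lE l0 E1 
      by (intro divide_right_mono mult_right_mono power_mono) auto
    also have "\<dots> = 8 * E ^ 3" by (simp add: eval_nat_numeral)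
    also have "\<dots> \<le> 8 * p" using Ep by simp
    finally show "l\<^sup>2 * E / 2 \<le> 8 * p" .
  qed (use lp p in auto)
  also have "\<dots> = 16" using p by simp
  finally have "2 * (2 * q - 1) * (ln (2 * q) / (2 * q)\<^sup>2) * (2 * K) \<le> 16" .
  moreover have "2 * (2 * q - 1) * (2 * K) * (ln (2 * q) / (2 * q)\<^sup>2)
      = 2 * (2 * q - 1) * (ln (2 * q) / (2 * q)\<^sup>2) * (2 * K)" by (simp only: mult_ac)
  ultimately show "2 * (2 * q - 1) * (2 * K) * (ln (2 * q) / (2 * q)\<^sup>2) \<le> 1024" by linarith
  \<comment> \<open>\<open>M\<close> is the base of the power in \<open>L\<close>, and the
    normalizing factor is at most \<open>16 / M\<close>. Hence M^q cancels, and only factors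
    polynomial in \<open>p\<close> remain to be absorbed.\<close>
  define M where "M = 4 / s"
  have M: "M = 8 * p / l" by (simp add: M_def s)
  have M8: "M \<ge> 8" using lp l0 p by (simp add: M field_simps)
  have "2 * l / p = 16 / M" using l0 p by (simp add: M)
  then have "(2 * (2 * q - 1) * (ln (2 * q) / (2 * q)\<^sup>2)) powr q \<le> (16 / M) powr q"
    using a a0 q by (intro powr_mono2) auto
  then have "(2 * (2 * q - 1) * (ln (2 * q) / (2 * q)\<^sup>2)) powr q * (q * L) \<le> (16 / M) powr q * (q * L)"
    using q \<open>0 \<le> L\<close> by (intro mult_right_mono) auto
  also have "\<dots> \<le> (16 / M) powr q * (q * (M powr (q - 2) * (M + p * E)))"
  proof (intro mult_left_mono)
    have "2 * (q - 1) * exp (s * (q - 1)) \<le> p * E"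
      using ex q E1 by (intro mult_mono) (auto simp: p_def)
    then show "L \<le> M powr (q - 2) * (M + p * E)"
      unfolding L_def M_def by (intro mult_left_mono) auto
  qed (use q in auto)
  also have "\<dots> = 16 powr q * (q * ((M + p * E) / M\<^sup>2))"
    using M8 by (simp add: powr_divide powr_diff field_simps)
  also have "\<dots> \<le> 16 powr q * (q * (2 * p\<^sup>2))"
  proof (intro mult_left_mono)
    have "M \<le> p\<^sup>2 * M\<^sup>2"
    proof -
      have "1 * M \<le> (p\<^sup>2 * M) * M"
        using p M8 mult_mono[of 1 "p\<^sup>2" 1 M] one_le_power[of p 2] by (intro mult_right_mono) auto
      then show ?thesis by (simp add: power2_eq_square mult_ac)
    qed
    moreover have "p * E \<le> p\<^sup>2 * M\<^sup>2"
    proof -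
      have "p * E * 1 \<le> p\<^sup>2 * M\<^sup>2"
        using Ep p M8 E1 one_le_power[of M 2] by (intro mult_mono) (auto simp: power2_eq_square)
      then show ?thesis by simp
    qed
    ultimately have "M + p * E \<le> (2 * p\<^sup>2) * M\<^sup>2" by simp
    then show "(M + p * E) / M\<^sup>2 \<le> 2 * p\<^sup>2"
      using M8 by (simp add: divide_le_eq)
  qed (use q in auto)
  also have "\<dots> = 16 powr q * (8 * (q * q * q))" by (simp add: p_def power2_eq_square)
  \<comment> \<open>Each of the three factors \<open>q\<close> is at most 2^q and 8 is at most 8^q;
    the product 16 * 8 * 2 * 2 * 2 = 1024 is the origin of this constant.\<close>
  also have "\<dots> \<le> 16 powr q * (8 powr q * (2 powr q * 2 powr q * 2 powr q))"
  proof -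
    have "q \<le> 2 powr q"
    proof -
      have "q \<le> (1 + q / 4)\<^sup>2"
        using zero_le_square[of "1 - q / 4"] by (simp add: power2_eq_square algebra_simps)
      also have "\<dots> \<le> (exp (q / 4))\<^sup>2"
        using q by (intro power_mono) (auto simp: exp_ge_add_one_self)
      also have "\<dots> = exp (q / 2)" by (simp flip: exp_double)
      also have "\<dots> \<le> exp (q * ln 2)"
      proof -
        have "1 / 2 \<le> ln (2::real)" using ln_le_minus_one[of "1 / 2"] by (simp add: ln_div)
        from mult_left_mono[OF this, of q] show ?thesis using q by simp
      qed
      also have "\<dots> = 2 powr q" by (simp add: powr_def)
      finally show ?thesis .
    qed
    moreover have "8 \<le> 8 powr q" using q powr_mono[of 1 q 8] by simp
    ultimately show ?thesis using q
      by (intro mult_left_mono mult_mono) auto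
  qed
  also have "\<dots> = 1024 powr q" by (simp flip: powr_mult)
  finally show "(2 * (2 * q - 1) * (ln (2 * q) / (2 * q)\<^sup>2)) powr q * (q * L) \<le> 1024 powr q" .
qed

text \<open>For \<open>q \<ge> 2\<close> the exponent \<open>q - 1\<close> is at least 1 and the
  convex estimate applies with the tuned threshold; for smaller \<open>q\<close> the concave one
  gives \<open>K = L = 1\<close>. The two numerical bounds concern exactly the coefficients that
  arise once the Khinchine constant and the factor ln p / p^2 are multiplied in.\<close>

lemma (in finite_index) trf_add_powr_le:
  fixes q :: real
  assumes q: "q \<ge> 1"
  shows "\<exists>K L. 1 \<le> K \<and> 0 \<le> L \<and>
    (\<forall>B Z. psd B \<longrightarrow> psd Z \<longrightarrow> trf B (\<lambda>y. y powr (q - 1)) (\<lambda>a b. Z a b + B a b)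
         \<le> K * trf B (\<lambda>y. y powr (q - 1)) Z + L * tr1 (\<lambda>x. x powr q) B) \<and>
    2 * (2 * q - 1) * (2 * K) * (ln (2 * q) / (2 * q)\<^sup>2) \<le> 1024 \<and>
    (2 * (2 * q - 1) * (ln (2 * q) / (2 * q)\<^sup>2)) powr q * (q * L) \<le> 1024 powr q"
proof (cases "q \<ge> 2")
  case True
  define s where "s = ln (2 * q) / (4 * q)"
  note c = rosenthal_constants[OF True, folded s_def]
  show ?thesis
  proof (rule exI, rule exI, intro conjI allI impI)
    fix B Z assume "psd B" "psd Z"
    from trf_add_powr_convex[OF this, of "q - 1" s]
    show "trf B (\<lambda>y. y powr (q - 1)) (\<lambda>a b. Z a b + B a b)
         \<le> (2 + (q - 1) * exp (s * (q - 1)) * s / 2) * trf B (\<lambda>y. y powr (q - 1)) Z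
          + (4 / s) powr (q - 2) * (4 / s + 2 * (q - 1) * exp (s * (q - 1))) * tr1 (\<lambda>x. x powr q) B"
      using True c(1,2) by simp
  qed (use c(3-6) in simp_all)
next
  case False
  define p where "p = 2 * q"
  have p: "p \<ge> 2" using q by (simp add: p_def)
  have "ln p \<le> p" using ln_le_minus_one[of p] p by simp
  then have a: "2 * (2 * q - 1) * (ln (2 * q) / (2 * q)\<^sup>2) \<le> 2"
  proof -
    assume "ln p \<le> p"
    then have "2 * (p - 1) * (ln p / p\<^sup>2) \<le> 2 * p * (p / p\<^sup>2)"
      using p by (intro mult_mono divide_right_mono) auto
    also have "\<dots> = 2" using p by (simp add: power2_eq_square)
    finally show ?thesis by (simp add: p_def)
  qed
  have a0: "0 \<le> 2 * (2 * q - 1) * (ln (2 * q) / (2 * q)\<^sup>2)" using q by simp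
  show ?thesis
  proof (rule exI[of _ 1], rule exI[of _ 1], intro conjI allI impI)
    fix B Z assume "psd B" "psd Z"
    from trf_add_powr_concave[OF this, of "q - 1"]
    show "trf B (\<lambda>y. y powr (q - 1)) (\<lambda>a b. Z a b + B a b)
         \<le> 1 * trf B (\<lambda>y. y powr (q - 1)) Z + 1 * tr1 (\<lambda>x. x powr q) B"
      using q False by simp
  next
    have "2 * (2 * q - 1) * (2 * 1) * x = 2 * (2 * (2 * q - 1) * x)" for x by simp
    then show "2 * (2 * q - 1) * (2 * 1) * (ln (2 * q) / (2 * q)\<^sup>2) \<le> 1024" using a by linarith
    have "(2 * (2 * q - 1) * (ln (2 * q) / (2 * q)\<^sup>2)) powr q * (q * 1) \<le> 2 powr q * 2 powr q"
    proof (intro mult_mono powr_mono2 a a0)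
      show "q * 1 \<le> 2 powr q" using False powr_mono[of 1 q 2] q by simp
    qed (use q in auto)
    also have "\<dots> = 4 powr q" by (simp flip: powr_mult)
    also have "\<dots> \<le> 1024 powr q" using q by (intro powr_mono2) auto
    finally show "(2 * (2 * q - 1) * (ln (2 * q) / (2 * q)\<^sup>2)) powr q * (q * 1) \<le> 1024 powr q" .
  qed auto
qed

lemma (in finite_index) symmetric_Xp_inequality:
  fixes H :: "nat \<Rightarrow> 'i \<Rightarrow> 'i \<Rightarrow> real" and p :: real
  assumes H: "\<And>j. j \<in> {1..n} \<Longrightarrow> sym_on I (H j)" and p: "p \<ge> 2" and k: "k \<le> n"
  defines "T \<equiv> tr1 (\<lambda>x. (x\<^sup>2) powr (p / 2))"
  shows "(p / sqrt (ln p)) powr (- p) / (2 ^ n * real (n choose k)) *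
      (\<Sum>S\<in>{S. S \<subseteq> {1..n} \<and> card S = k}. \<Sum>\<epsilon>\<in>sign_vectors n. T (\<lambda>a b. \<Sum>j\<in>S. \<epsilon> j * H j a b))
    \<le> 32 powr p * (real k / real n * (\<Sum>j=1..n. T (H j))
       + (real k / real n) powr (p / 2) / 2 ^ n *
          (\<Sum>\<epsilon>\<in>sign_vectors n. T (\<lambda>a b. \<Sum>j\<in>{1..n}. \<epsilon> j * H j a b)))"
proof -
  define q where "q = p / 2"
  have q: "q \<ge> 1" "p = 2 * q" using p by (auto simp: q_def)
  obtain K L where K: "1 \<le> K" and L: "0 \<le> L"
    and key: "\<forall>B Z. psd B \<longrightarrow> psd Z \<longrightarrow> trf B (\<lambda>y. y powr (q - 1)) (\<lambda>a b. Z a b + B a b)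
         \<le> K * trf B (\<lambda>y. y powr (q - 1)) Z + L * tr1 (\<lambda>x. x powr q) B"
    and c1: "2 * (2 * q - 1) * (2 * K) * (ln (2 * q) / (2 * q)\<^sup>2) \<le> 1024"
    and c2: "(2 * (2 * q - 1) * (ln (2 * q) / (2 * q)\<^sup>2)) powr q * (q * L) \<le> 1024 powr q"
    using trf_add_powr_le[OF q(1)] by (elim exE conjE)
  define N where "N = {S. S \<subseteq> {1..n} \<and> card S = k}"
  define C where "C = real (n choose k)"
  define a where "a = 2 * (2 * q - 1)"
  define g where "g = ln (2 * q) / (2 * q)\<^sup>2"
  define \<tau> where "\<tau> = tr1 (\<lambda>x. x powr q)"
  define V where "V = (\<lambda>S a b. \<Sum>j\<in>S. sq (H j) a b)"
  define R where "R = (\<Sum>\<epsilon>\<in>sign_vectors n. T (\<lambda>a b. \<Sum>j\<in>{1..n}. \<epsilon> j * H j a b))"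
  define \<beta> where "\<beta> = (\<Sum>j=1..n. T (H j))"
  have C: "C > 0" using k by (simp add: C_def)
  have a0: "a \<ge> 0" and g0: "g \<ge> 0" using q by (auto simp: a_def g_def)
  have T: "T = tr1 (\<lambda>x. (x\<^sup>2) powr q)" by (simp add: T_def q_def)
  have Tnn: "T M \<ge> 0" for M by (simp add: T_def tr1_def sum_nonneg)
  have \<beta>: "\<beta> = (\<Sum>j\<in>{1..n}. \<tau> (sq (H j)))"
    unfolding \<beta>_def T \<tau>_def using H by (intro sum.cong refl) (simp add: tr1_sq)
  have \<beta>0: "\<beta> \<ge> 0" by (simp add: \<beta>_def sum_nonneg Tnn)
  have R0: "R \<ge> 0" by (simp add: R_def sum_nonneg Tnn)
  have "(\<Sum>S\<in>N. \<Sum>\<epsilon>\<in>sign_vectors n. T (\<lambda>a b. \<Sum>j\<in>S. \<epsilon> j * H j a b)) \<le> (\<Sum>S\<in>N. 2 ^ n * (a powr q * \<tau> (V S)))"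
    unfolding N_def T \<tau>_def V_def a_def by (intro sum_mono khinchine_upper H q(1)) auto
  also have "\<dots> = 2 ^ n * a powr q * (\<Sum>S\<in>N. \<tau> (V S))" by (simp add: sum_distrib_left mult_ac)
  also have "\<dots> \<le> 2 ^ n * a powr q * (C * ((2 * K * (real k / real n)) powr q * \<tau> (V {1..n}) + q * L * (real k / real n) * \<beta>))"
    using rosenthal_psd_subsets[of "{1..n}" "\<lambda>j. sq (H j)" q K L k] H key psd_sq q(1) K L k
    unfolding N_def \<tau>_def V_def C_def \<beta>
    by (intro mult_left_mono) auto
  also have "\<dots> \<le> 2 ^ n * a powr q * (C * ((2 * K * (real k / real n)) powr q * (R / 2 ^ n) + q * L * (real k / real n) * \<beta>))"
  proof -
    have "\<tau> (V {1..n}) \<le> R / 2 ^ n"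
      using khinchine_lower[OF H order_refl q(1)]
      unfolding \<tau>_def V_def R_def T by (simp add: field_simps)
    then show ?thesis using C by (intro mult_left_mono add_right_mono) auto
  qed
  finally have main: "(\<Sum>S\<in>N. \<Sum>\<epsilon>\<in>sign_vectors n. T (\<lambda>a b. \<Sum>j\<in>S. \<epsilon> j * H j a b))
     \<le> 2 ^ n * a powr q * (C * ((2 * K * (real k / real n)) powr q * (R / 2 ^ n) + q * L * (real k / real n) * \<beta>))" .
  \<comment> \<open>Since p = 2 q, the normalization is a \<open>q\<close>-th power and can be
    merged with the constants under one exponent.\<close>
  have D: "(p / sqrt (ln p)) powr (- p) = g powr q"
  proof -
    have l: "ln p > 0" using p by simp
    define x where "x = p / sqrt (ln p)"
    have x: "x > 0" using l p by (simp add: x_def)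
    have "x\<^sup>2 = p\<^sup>2 / ln p" using l by (simp add: x_def power_divide)
    then have g: "g = 1 / x\<^sup>2" unfolding g_def q(2)[symmetric] by simp
    have "x powr (- p) = (x powr (- 2)) powr q" unfolding powr_powr q(2) by simp
    also have "x powr (- 2) = g" using x by (simp add: g powr_minus_divide)
    finally show ?thesis by (simp add: x_def)
  qed
  have "g powr q / (2 ^ n * C) * (\<Sum>S\<in>N. \<Sum>\<epsilon>\<in>sign_vectors n. T (\<lambda>a b. \<Sum>j\<in>S. \<epsilon> j * H j a b))
    \<le> g powr q / (2 ^ n * C) * (2 ^ n * a powr q * (C * ((2 * K * (real k / real n)) powr q * (R / 2 ^ n) + q * L * (real k / real n) * \<beta>)))"
    using C by (intro mult_left_mono main) auto
  also have "\<dots> = (a * g) powr q * ((2 * K * (real k / real n)) powr q * (R / 2 ^ n) + q * L * (real k / real n) * \<beta>)"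
    using C a0 g0 by (simp add: powr_mult)
  also have "\<dots> = (a * g) powr q * (q * L) * (real k / real n * \<beta>)
      + (a * (2 * K) * g) powr q * ((real k / real n) powr q / 2 ^ n * R)"
  proof -
    define t where "t = real k / real n"
    have "t \<ge> 0" by (simp add: t_def)
    then have 1: "(2 * K * t) powr q = (2 * K) powr q * t powr q" using K by (intro powr_mult; auto)
    have "(a * g * (2 * K)) powr q = (a * g) powr q * (2 * K) powr q"
      using K a0 g0 by (intro powr_mult; auto)
    then have 2: "(a * (2 * K) * g) powr q = (a * g) powr q * (2 * K) powr q" by (simp only: mult_ac)
    show ?thesis unfolding t_def[symmetric] 1 2 by (simp only: distrib_left times_divide_eq_right times_divide_eq_left mult_ac add_ac)
  qed
  also have "\<dots> \<le> 1024 powr q * (real k / real n * \<beta>) + 1024 powr q * ((real k / real n) powr q / 2 ^ n * R)"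
    using c1 c2 a0 g0 K q R0 \<beta>0
    by (intro add_mono mult_right_mono powr_mono2) (auto simp: a_def g_def)
  also have "\<dots> = 32 powr p * (real k / real n * \<beta> + (real k / real n) powr (p / 2) / 2 ^ n * R)"
  proof -
    \<comment> \<open>The constant 32 is the square root of 1024, again because p = 2 q.\<close>
    have "32 powr p = (32 powr 2) powr q" unfolding powr_powr q(2) by simp
    also have "(32::real) powr 2 = 1024" by simp
    finally show ?thesis by (simp add: distrib_left q_def)
  qed
  finally show ?thesis unfolding D N_def C_def R_def \<beta>_def .
qed

section \<open>Passage to Schatten norms\<close>

text \<open>The block matrix with \<open>X\<close> and its transpose off the diagonal. It depends
  linearly on \<open>X\<close>, so it commutes with signed sums, and its square has the diagonal
  blocks X X^T and X^T X.\<close>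

definition dilation :: "('i \<Rightarrow> 'i \<Rightarrow> real) \<Rightarrow> 'i + 'i \<Rightarrow> 'i + 'i \<Rightarrow> real" where
  "dilation X x y = (case x of
      Inl a \<Rightarrow> (case y of Inl b \<Rightarrow> 0 | Inr b \<Rightarrow> X a b)
    | Inr a \<Rightarrow> (case y of Inl b \<Rightarrow> X b a | Inr b \<Rightarrow> 0))"

lemma dilation_simps [simp]:
  "dilation X (Inl a) (Inl b) = 0" "dilation X (Inl a) (Inr b) = X a b"
  "dilation X (Inr a) (Inl b) = X b a" "dilation X (Inr a) (Inr b) = 0"
  by (simp_all add: dilation_def)

lemma sym_on_dilation: "sym_on J (dilation X)"
  unfolding sym_on_def by (auto simp: dilation_def split: sum.split)

lemma dilation_sum:
  "dilation (\<lambda>a b. \<Sum>j\<in>S. c j * A j a b) = (\<lambda>x y. \<Sum>j\<in>S. c j * dilation (A j) x y)"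
  by (intro ext) (auto simp: dilation_def split: sum.split)

context finite_index
begin

definition gram :: "('i \<Rightarrow> 'i \<Rightarrow> real) \<Rightarrow> 'i \<Rightarrow> 'i \<Rightarrow> real" where
  "gram X a b = (\<Sum>c\<in>I. X c a * X c b)"

lemma sym_on_gram: "sym_on I (gram X)"
  by (simp add: sym_on_def gram_def mult.commute)

lemma qform_gram: "qform (gram X) v = ip (\<lambda>c. \<Sum>a\<in>I. X c a * v a) (\<lambda>c. \<Sum>a\<in>I. X c a * v a)"
proof -
  have "qform (gram X) v = (\<Sum>a\<in>I. \<Sum>b\<in>I. \<Sum>c\<in>I. (X c a * v a) * (X c b * v b))"
    unfolding qform_def gram_def by (simp add: sum_distrib_left sum_distrib_right mult_ac)
  also have "\<dots> = (\<Sum>a\<in>I. \<Sum>c\<in>I. \<Sum>b\<in>I. (X c a * v a) * (X c b * v b))"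
    by (intro sum.cong refl sum.swap)
  also have "\<dots> = (\<Sum>c\<in>I. \<Sum>a\<in>I. \<Sum>b\<in>I. (X c a * v a) * (X c b * v b))"
    by (rule sum.swap)
  finally show ?thesis by (simp add: ip_def sum_product)
qed

lemma ip_adjoint: "ip w (\<lambda>c. \<Sum>a\<in>I. X c a * v a) = ip (\<lambda>a. \<Sum>c\<in>I. X c a * w c) v"
proof -
  have "ip w (\<lambda>c. \<Sum>a\<in>I. X c a * v a) = (\<Sum>c\<in>I. \<Sum>a\<in>I. X c a * w c * v a)"
    by (simp add: ip_def sum_distrib_left mult_ac)
  also have "\<dots> = (\<Sum>a\<in>I. \<Sum>c\<in>I. X c a * w c * v a)" by (rule sum.swap)
  finally show ?thesis by (simp add: ip_def sum_distrib_right)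
qed

lemma gram_apply: "(\<Sum>b\<in>I. gram X a b * v b) = (\<Sum>c\<in>I. X c a * (\<Sum>b\<in>I. X c b * v b))"
proof -
  have "(\<Sum>b\<in>I. gram X a b * v b) = (\<Sum>b\<in>I. \<Sum>c\<in>I. X c a * (X c b * v b))"
    by (simp add: gram_def sum_distrib_left sum_distrib_right mult_ac)
  then show ?thesis by (subst (asm) sum.swap) (simp add: sum_distrib_left)
qed

text \<open>The weights \<open>\<langle>X u\<^sub>i, v\<^sub>j\<rangle>\<^sup>2\<close> are supported on pairs with equal eigenvalues and have
  row and column sums equal to the eigenvalues, so \<open>X\<^sup>T X\<close> and \<open>X X\<^sup>T\<close> have the same nonzero
  spectrum.\<close>

lemma tr1_gram_transpose:
  assumes f: "f 0 = 0"
  shows "tr1 f (gram X) = tr1 f (gram (\<lambda>a b. X b a))"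
proof -
  define G where "G = gram X"
  define G' where "G' = gram (\<lambda>a b. X b a)"
  have sG: "sym_on I G" "sym_on I G'" unfolding G_def G'_def by (rule sym_on_gram)+
  define Xu where "Xu = (\<lambda>i c. \<Sum>a\<in>I. X c a * eu G i a)"
  define Xv where "Xv = (\<lambda>j a. \<Sum>c\<in>I. X c a * eu G' j c)"
  define W where "W = (\<lambda>i j. ip (Xu i) (eu G' j))"
  have W': "W i j = ip (Xv j) (eu G i)" for i j
    unfolding W_def Xu_def Xv_def by (subst ip_commute) (rule ip_adjoint)
  have row: "(\<Sum>j\<in>I. (W i j)\<^sup>2) = ev G i" if "i \<in> I" for i
    using parseval[OF eigenbasis_ev[OF sG(2)], of "Xu i"] qform_gram[of X "eu G i"] qform_ev[OF sG(1) that]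
    unfolding W_def Xu_def G_def by simp
  have col: "(\<Sum>i\<in>I. (W i j)\<^sup>2) = ev G' j" if "j \<in> I" for j
    using parseval[OF eigenbasis_ev[OF sG(1)], of "Xv j"] qform_gram[of "\<lambda>a b. X b a" "eu G' j"] qform_ev[OF sG(2) that]
    unfolding W' Xv_def G'_def by simp
  have eq: "ev G i * W i j = ev G' j * W i j" if i: "i \<in> I" and j: "j \<in> I" for i j
  proof -
    have Gu: "ev G i * eu G i a = (\<Sum>c\<in>I. X c a * Xu i c)" if "a \<in> I" for a
    proof -
      have "(\<Sum>b\<in>I. G a b * eu G i b) = ev G i * eu G i a"
        using eigenbasis_ev[OF sG(1)] i that unfolding eigenbasis_def by blast
      then show ?thesis by (simp add: G_def gram_apply Xu_def)
    qed
    have Gv: "ev G' j * eu G' j a = (\<Sum>c\<in>I. X a c * Xv j c)" if "a \<in> I" for a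
    proof -
      have "(\<Sum>b\<in>I. G' a b * eu G' j b) = ev G' j * eu G' j a"
        using eigenbasis_ev[OF sG(2)] j that unfolding eigenbasis_def by blast
      then show ?thesis by (simp add: G'_def gram_apply Xv_def)
    qed
    have "ev G i * W i j = ip (Xv j) (\<lambda>a. ev G i * eu G i a)"
      unfolding W' by (simp add: ip_def sum_distrib_left mult_ac)
    also have "\<dots> = ip (Xv j) (\<lambda>a. \<Sum>c\<in>I. X c a * Xu i c)"
      unfolding ip_def by (rule sum.cong[OF refl]) (simp add: Gu)
    also have "\<dots> = ip (\<lambda>c. \<Sum>a\<in>I. X c a * Xv j a) (Xu i)"
      using ip_adjoint[of "Xv j" "\<lambda>a c. X c a" "Xu i"] by simp
    also have "\<dots> = ip (\<lambda>c. ev G' j * eu G' j c) (Xu i)"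
      unfolding ip_def by (rule sum.cong[OF refl]) (simp add: Gv)
    also have "\<dots> = ev G' j * W i j"
      unfolding W_def ip_commute[of "Xu i"] by (simp add: ip_def sum_distrib_left mult_ac)
    finally show ?thesis .
  qed
  \<comment> \<open>With 1/0 = 0 and \<open>f 0 = 0\<close>, \<open>f x = g x * x\<close> holds at 0
    too. The factor \<open>x\<close> is then replaced by a row or column sum of the squared entries
    of \<open>W\<close>.\<close>
  define g where "g = (\<lambda>x. f x / x)"
  have fg: "f x = g x * x" for x using f by (simp add: g_def)
  have "tr1 f G = (\<Sum>i\<in>I. \<Sum>j\<in>I. g (ev G i) * (W i j)\<^sup>2)"
    unfolding tr1_def by (intro sum.cong refl) (simp add: fg row flip: sum_distrib_left)
  also have "\<dots> = (\<Sum>i\<in>I. \<Sum>j\<in>I. g (ev G' j) * (W i j)\<^sup>2)"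
  proof (intro sum.cong refl)
    fix i j assume "i \<in> I" "j \<in> I"
    then show "g (ev G i) * (W i j)\<^sup>2 = g (ev G' j) * (W i j)\<^sup>2"
      using eq[of i j] by (cases "W i j = 0") auto
  qed
  also have "\<dots> = (\<Sum>j\<in>I. \<Sum>i\<in>I. g (ev G' j) * (W i j)\<^sup>2)" by (rule sum.swap)
  also have "\<dots> = tr1 f G'"
    unfolding tr1_def by (intro sum.cong refl) (simp add: fg col flip: sum_distrib_left)
  finally show ?thesis unfolding G_def G'_def .
qed

lemma sum_Plus:
  fixes g :: "'i + 'i \<Rightarrow> real"
  shows "(\<Sum>x\<in>I <+> I. g x) = (\<Sum>a\<in>I. g (Inl a)) + (\<Sum>b\<in>I. g (Inr b))"
  by (simp add: sum.Plus[OF finI finI] comp_def)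

lemma finite_index_Plus: "finite_index (I <+> I)"
  by unfold_locales (simp add: finI)

text \<open>The square of the dilation is block diagonal, so eigenbases of X X^T and X^T X glue to
  one of it. By \<open>tr1_gram_transpose\<close> the two blocks contribute equally, whence the
  factor 2.\<close>

lemma tr1_dilation:
  assumes f: "f 0 = 0"
  shows "finite_index.tr1 (I <+> I) (\<lambda>x. f (x\<^sup>2)) (dilation X) = 2 * tr1 f (gram X)"
proof -
  interpret D: finite_index "I <+> I" by (rule finite_index_Plus)
  define G where "G = gram X"
  define G' where "G' = gram (\<lambda>a b. X b a)"
  have e: "eigenbasis I G (ev G) (eu G)" "eigenbasis I G' (ev G') (eu G')"
    unfolding G_def G'_def by (rule eigenbasis_ev[OF sym_on_gram])+
  have sq: "D.sq (dilation X) x y = (case x of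
      Inl a \<Rightarrow> (case y of Inl b \<Rightarrow> G' a b | Inr b \<Rightarrow> 0)
    | Inr a \<Rightarrow> (case y of Inl b \<Rightarrow> 0 | Inr b \<Rightarrow> G a b))" for x y
    by (cases x; cases y) (simp_all add: D.sq_def sum_Plus G_def G'_def gram_def)
  define u where "u = (\<lambda>x y. case x of
      Inl a \<Rightarrow> (case y of Inl b \<Rightarrow> eu G' a b | Inr b \<Rightarrow> 0)
    | Inr a \<Rightarrow> (case y of Inl b \<Rightarrow> 0 | Inr b \<Rightarrow> eu G a b))"
  define l where "l = case_sum (ev G') (ev G)"
  have "eigenbasis (I <+> I) (D.sq (dilation X)) l u"
    unfolding eigenbasis_def
  proof (intro conjI ballI)
    fix i j assume "i \<in> I <+> I" "j \<in> I <+> I"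
    then show "(\<Sum>a\<in>I <+> I. u i a * u j a) = (if i = j then 1 else 0)"
      using e unfolding sum_Plus u_def eigenbasis_def by (cases i; cases j) auto
  next
    fix a b assume "a \<in> I <+> I" "b \<in> I <+> I"
    then show "(\<Sum>i\<in>I <+> I. u i a * u i b) = (if a = b then 1 else 0)"
      using e unfolding sum_Plus u_def eigenbasis_def by (cases a; cases b) auto
  next
    fix i a assume "i \<in> I <+> I" "a \<in> I <+> I"
    then show "(\<Sum>b\<in>I <+> I. D.sq (dilation X) a b * u i b) = l i * u i a"
      using e unfolding sum_Plus u_def l_def sq eigenbasis_def by (cases i; cases a) auto
  qed
  then have "D.tr1 f (D.sq (dilation X)) = (\<Sum>i\<in>I <+> I. f (l i))"
    by (rule D.tr1_eq[OF _ D.sym_on_sq[OF sym_on_dilation]])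
  also have "\<dots> = tr1 f G' + tr1 f G" by (simp add: sum_Plus l_def tr1_def)
  also have "\<dots> = 2 * tr1 f G" using tr1_gram_transpose[of f X] f by (simp add: G_def G'_def)
  finally show ?thesis using D.tr1_sq[OF sym_on_dilation, of f X] by (simp add: G_def)
qed

end

section \<open>Characteristic polynomials and multiplicities of eigenvalues\<close>

lemma order_prod_list_linear:
  "order x (\<Prod>a\<leftarrow>xs. [:- a, 1:]) = count_list xs (x::real)"
proof (induction xs)
  case (Cons a xs)
  have nz: "(\<Prod>a\<leftarrow>xs. [:- a, 1:]) \<noteq> 0" for xs :: "real list"
    by (subst prod_list_zero_iff) auto
  have "order x [:- a, 1:] = (if a = x then 1 else 0)"
    using order_power_n_n[of x 1] by (auto intro: order_0I)
  then show ?case using Cons nz[of "a # xs"] by (simp add: order_mult del: mult_pCons_left)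
qed simp

lemma poly_prod_list_linear_roots: "{y. poly (\<Prod>a\<leftarrow>xs. [:- a, 1:]) y = 0} = set (xs :: real list)"
  by (induction xs) auto

text \<open>Diagonalization by the orthogonal matrix of eigenvectors:
  \<open>P * Q = 1\<^sub>m d\<close> is completeness and \<open>Q * P = 1\<^sub>m d\<close> is
  orthonormality, and similar matrices share their characteristic polynomial.\<close>

lemma char_poly_eigenbasis:
  fixes M :: "real mat"
  assumes M: "M \<in> carrier_mat d d" and e: "eigenbasis {..<d} (\<lambda>a b. M $$ (a, b)) l u"
  shows "char_poly M = (\<Prod>a\<leftarrow>map l [0..<d]. [:- a, 1:])"
proof -
  define P where "P = Matrix.mat d d (\<lambda>(a, i). u i a)"
  define Q where "Q = Matrix.mat d d (\<lambda>(i, a). u i a)"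
  define D where "D = Matrix.mat d d (\<lambda>(i, j). if i = j then l i else 0)"
  have car: "P \<in> carrier_mat d d" "Q \<in> carrier_mat d d" "D \<in> carrier_mat d d"
    by (auto simp: P_def Q_def D_def)
  interpret finite_index "{..<d}" by unfold_locales simp
  have at: "{0..<d} = {..<d}" by auto
  have "P * Q = 1\<^sub>m d"
    using e unfolding eigenbasis_def
    by (intro eq_matI) (auto simp: P_def Q_def scalar_prod_def at)
  moreover have "Q * P = 1\<^sub>m d"
    using e unfolding eigenbasis_def
    by (intro eq_matI) (auto simp: P_def Q_def scalar_prod_def at)
  moreover have "M = P * D * Q"
  proof (intro eq_matI)
    fix a b assume ab: "a < dim_row (P * D * Q)" "b < dim_col (P * D * Q)"
    have PD: "(P * D) $$ (a, i) = u i a * l i" if "i < d" for i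
    proof -
      have "(P * D) $$ (a, i) = (\<Sum>k<d. u k a * (if k = i then l k else 0))"
        using ab that by (simp add: P_def D_def scalar_prod_def at)
      also have "\<dots> = (\<Sum>k<d. if k = i then u i a * l i else 0)"
        by (rule sum.cong[OF refl]) simp
      finally have "(P * D) $$ (a, i) = (\<Sum>k<d. if k = i then u i a * l i else 0)" .
      then show ?thesis using that by simp
    qed
    have "(P * D * Q) $$ (a, b) = (\<Sum>i<d. (P * D) $$ (a, i) * u i b)"
      using ab car by (simp add: Q_def scalar_prod_def at)
    also have "\<dots> = (\<Sum>i<d. l i * u i a * u i b)"
      by (intro sum.cong refl) (simp add: PD)
    also have "\<dots> = M $$ (a, b)" using eigenbasis_entry[OF e, of a b] ab car by auto
    finally show "M $$ (a, b) = (P * D * Q) $$ (a, b)" by simp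
  qed (use M car in auto)
  ultimately have "similar_mat M D" using M car by (intro similar_matI[of M D P Q d]) auto
  then have "char_poly M = char_poly D" by (rule char_poly_similar)
  also have "\<dots> = (\<Prod>a\<leftarrow>diag_mat D. [:- a, 1:])"
    by (rule char_poly_upper_triangular[OF car(3)]) (auto simp: D_def)
  also have "diag_mat D = map l [0..<d]" by (auto simp: diag_mat_def D_def)
  finally show ?thesis .
qed

text \<open>The characteristic polynomial of X^T X splits over the list of its eigenvalues, so the
  order of a root counts its repetitions in that list. The sum over distinct roots with multiplicity
  is therefore the trace of the power.\<close>

lemma schatten_trace_pow_dilation:
  assumes X: "X \<in> carrier_mat d d" and p: "p \<ge> 2"
  shows "schatten_trace_pow p X
    = finite_index.tr1 ({..<d} <+> {..<d}) (\<lambda>x. (x\<^sup>2) powr (p / 2)) (dilation (\<lambda>a b. X $$ (a, b))) / 2"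
proof -
  interpret finite_index "{..<d}" by unfold_locales simp
  define M where "M = transpose_mat X * X"
  have M: "M \<in> carrier_mat d d" using X by (auto simp: M_def)
  have entry: "M $$ (a, b) = gram (\<lambda>a b. X $$ (a, b)) a b" if "a \<in> {..<d}" "b \<in> {..<d}" for a b
    using X that by (auto simp: M_def gram_def scalar_prod_def atLeast0LessThan intro!: sum.cong)
  define G where "G = gram (\<lambda>a b. X $$ (a, b))"
  have sG: "sym_on {..<d} G" unfolding G_def by (rule sym_on_gram)
  have "eigenbasis {..<d} (\<lambda>a b. M $$ (a, b)) (ev G) (eu G)"
    using eigenbasis_ev[OF sG] entry unfolding eigenbasis_def G_def[symmetric] by simp
  then have cp: "char_poly M = (\<Prod>a\<leftarrow>map (ev G) [0..<d]. [:- a, 1:])"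
    by (rule char_poly_eigenbasis[OF M])
  have "schatten_trace_pow p X = (\<Sum>x\<in>set (map (ev G) [0..<d]). real (count_list (map (ev G) [0..<d]) x) * x powr (p / 2))"
    unfolding schatten_trace_pow_def Let_def M_def[symmetric] cp order_prod_list_linear poly_prod_list_linear_roots
    by (rule refl)
  also have "\<dots> = (\<Sum>x\<leftarrow>map (ev G) [0..<d]. x powr (p / 2))"
  proof -
    have "(\<Sum>x\<in>set xs. real (count_list xs x) * f x) = (\<Sum>x\<leftarrow>xs. f x)" for xs :: "real list" and f :: "real \<Rightarrow> real"
    proof (induction xs)
      case (Cons a xs)
      have "(\<Sum>x\<in>set (a # xs). real (count_list (a # xs) x) * f x)
          = (\<Sum>x\<in>set (a # xs). real (count_list xs x) * f x + (if x = a then f a else 0))"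
        by (intro sum.cong refl) (simp add: distrib_right)
      also have "\<dots> = (\<Sum>x\<in>set (a # xs). real (count_list xs x) * f x) + f a"
        by (simp add: sum.distrib)
      also have "(\<Sum>x\<in>set (a # xs). real (count_list xs x) * f x) = (\<Sum>x\<in>set xs. real (count_list xs x) * f x)"
        by (intro sum.mono_neutral_right) (auto simp: count_list_0_iff)
      finally show ?case using Cons by simp
    qed simp
    then show ?thesis .
  qed
  also have "\<dots> = tr1 (\<lambda>x. x powr (p / 2)) G"
    by (simp add: tr1_def interv_sum_list_conv_sum_set_nat comp_def atLeast0LessThan)
  also have "\<dots> = finite_index.tr1 ({..<d} <+> {..<d}) (\<lambda>x. (x\<^sup>2) powr (p / 2)) (dilation (\<lambda>a b. X $$ (a, b))) / 2"
    using tr1_dilation[of "\<lambda>x. x powr (p / 2)" "\<lambda>a b. X $$ (a, b)"] by (simp add: G_def)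
  finally show ?thesis .
qed

lemma schatten_norm_powr:
  assumes "p \<ge> 2" shows "schatten_norm p X powr p = schatten_trace_pow p X"
proof -
  have "schatten_trace_pow p X \<ge> 0"
    unfolding schatten_trace_pow_def Let_def by (intro sum_nonneg mult_nonneg_nonneg) auto
  then show ?thesis using assms by (simp add: schatten_norm_def powr_powr)
qed

theorem mainTheorem16:
  shows "\<exists>c::real. c > 0 \<and>
    (\<forall>p::real. p \<ge> 2 \<longrightarrow>
     (\<forall>(d::nat) (n::nat) (k::nat) (A::nat \<Rightarrow> real mat).
        1 \<le> k \<and> k \<le> n \<and> (\<forall>j\<in>{1..n}. A j \<in> carrier_mat d d) \<longrightarrow>
        (p / sqrt (ln p)) powr (-p) / (2 ^ n * real (n choose k)) *
          (\<Sum>S\<in>{S. S \<subseteq> {1..n} \<and> card S = k}. \<Sum>\<epsilon>\<in>sign_vectors n.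
              schatten_norm p (signed_sum d S \<epsilon> A) powr p)
        \<le> c powr p *
          (real k / real n * (\<Sum>j=1..n. schatten_norm p (A j) powr p)
           + (real k / real n) powr (p / 2) / 2 ^ n *
             (\<Sum>\<epsilon>\<in>sign_vectors n. schatten_norm p (signed_sum d {1..n} \<epsilon> A) powr p))))"
proof (intro exI[of _ 32] conjI allI impI)
  fix p :: real and d n k :: nat and A :: "nat \<Rightarrow> real mat"
  assume p: "p \<ge> 2" and h: "1 \<le> k \<and> k \<le> n \<and> (\<forall>j\<in>{1..n}. A j \<in> carrier_mat d d)"
  define J where "J = {..<d} <+> {..<d}"
  interpret D: finite_index J by unfold_locales (simp add: J_def)
  define H where "H = (\<lambda>j. dilation (\<lambda>a b. A j $$ (a, b)))"
  define T where "T = D.tr1 (\<lambda>x. (x\<^sup>2) powr (p / 2))"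
  have nA: "schatten_norm p (A j) powr p = T (H j) / 2" if "j \<in> {1..n}" for j
    using schatten_trace_pow_dilation[of "A j" d p] h p that
    by (simp add: schatten_norm_powr T_def H_def J_def)
  \<comment> \<open>The entries of \<open>signed_sum\<close> are specified only for indices below
    \<open>d\<close>, so the two dilations agree on \<open>J\<close> but need not be equal as
    functions. Agreement on \<open>J\<close> makes an eigenbasis of one an eigenbasis of the other,
    and \<open>D.tr1_eq\<close> compares the traces.\<close>
  have nS: "schatten_norm p (signed_sum d S \<epsilon> A) powr p = T (\<lambda>x y. \<Sum>j\<in>S. \<epsilon> j * H j x y) / 2" for S \<epsilon>
  proof -
    define X where "X = (\<lambda>a b. \<Sum>j\<in>S. \<epsilon> j * A j $$ (a, b))"
    define Y where "Y = (\<lambda>a b. signed_sum d S \<epsilon> A $$ (a, b))"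
    have "dilation Y x y = dilation X x y" if "x \<in> J" "y \<in> J" for x y
      using that by (auto simp: J_def Y_def signed_sum_def X_def dilation_def)
    then have "eigenbasis J (dilation Y) (D.ev (dilation X)) (D.eu (dilation X))"
      using D.eigenbasis_ev[OF sym_on_dilation, of X] unfolding eigenbasis_def by simp
    then have XY: "D.tr1 f (dilation Y) = D.tr1 f (dilation X)" for f
      unfolding D.tr1_def[of f "dilation X"] by (rule D.tr1_eq[OF _ sym_on_dilation])
    have "signed_sum d S \<epsilon> A \<in> carrier_mat d d" by (simp add: signed_sum_def)
    from schatten_trace_pow_dilation[OF this p, folded J_def Y_def]
    have "schatten_norm p (signed_sum d S \<epsilon> A) powr p = D.tr1 (\<lambda>x. (x\<^sup>2) powr (p / 2)) (dilation X) / 2"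
      by (simp only: schatten_norm_powr[OF p] XY)
    then show ?thesis unfolding T_def X_def H_def dilation_sum .
  qed
  have main: "(p / sqrt (ln p)) powr (- p) / (2 ^ n * real (n choose k)) *
      (\<Sum>S\<in>{S. S \<subseteq> {1..n} \<and> card S = k}. \<Sum>\<epsilon>\<in>sign_vectors n. T (\<lambda>a b. \<Sum>j\<in>S. \<epsilon> j * H j a b))
    \<le> 32 powr p * (real k / real n * (\<Sum>j=1..n. T (H j))
       + (real k / real n) powr (p / 2) / 2 ^ n *
          (\<Sum>\<epsilon>\<in>sign_vectors n. T (\<lambda>a b. \<Sum>j\<in>{1..n}. \<epsilon> j * H j a b)))"
    unfolding T_def using h by (intro D.symmetric_Xp_inequality p) (auto simp: H_def sym_on_dilation)
  have sumA: "(\<Sum>j=1..n. schatten_norm p (A j) powr p) = (\<Sum>j=1..n. T (H j)) / 2"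
    unfolding sum_divide_distrib by (intro sum.cong refl nA)
  \<comment> \<open>All three sums carry the same factor 1/2 from the dilation, so it
    cancels.\<close>
  have half: "C * Z \<le> M * (t * B + r * R) \<Longrightarrow> C * (Z / 2) \<le> M * (t * (B / 2) + r * (R / 2))"
    for C Z M t B r R :: real
    by (simp add: algebra_simps)
  show "(p / sqrt (ln p)) powr (-p) / (2 ^ n * real (n choose k)) *
          (\<Sum>S\<in>{S. S \<subseteq> {1..n} \<and> card S = k}. \<Sum>\<epsilon>\<in>sign_vectors n.
              schatten_norm p (signed_sum d S \<epsilon> A) powr p)
        \<le> 32 powr p *
          (real k / real n * (\<Sum>j=1..n. schatten_norm p (A j) powr p)
           + (real k / real n) powr (p / 2) / 2 ^ n *
             (\<Sum>\<epsilon>\<in>sign_vectors n. schatten_norm p (signed_sum d {1..n} \<epsilon> A) powr p))"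
    unfolding nS sumA sum_divide_distrib[symmetric] by (rule half[OF main])
qed simp

end
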